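(* Consider the target factor model with Assumptions (A1)–(A4), (A6)(1) and (A7) of the context, suppose $\alpha_s>1/2$ and $r_0\ge1$. Let $\hat{\boldsymbol\Sigma}^{(0)}=\mathbf X^{(0)\top}\mathbf X^{(0)}/T_0$ and $\hat r_0=\arg\max_{1\le r\le r_{\max}}\lambda_r(\hat{\boldsymbol\Sigma}^{(0)})/\lambda_{r+1}(\hat{\boldsymbol\Sigma}^{(0)})$. Then for any $r_{\max}\in\big(r_0,\lfloor c(N\wedge T_0)\rfloor-r_0-1\big]$ (with $c$ from (A7)), $P(\hat r_0=r_0)\to1$ as $\min\{N,T_0\}\to\infty$.
   Context: Model. $N$ is the cross-sectional dimension. Target $\mathbf X^{(0)}=\mathbf F^{(0)}\boldsymbol\Lambda^{(0)\top}+\mathbf E^{(0)}\in\mathbb R^{T_0\times N}$, $\mathbf F^{(0)}=(\mathbf f^{(0)}_1,\dots,\mathbf f^{(0)}_{T_0})^\top\in\mathbb R^{T_0\times r_0}$, $\boldsymbol\Lambda^{(0)}\in\mathbb R^{N\times r_0}$, errors with entries $\epsilon^{(0)}_{ti}$; of the $r_0$ factors, $r_0-s$ are strong and $s$ weak. Source panels $\mathbf X^{(k)}=\mathbf F^{(k)}\boldsymbol\Lambda^{(k)\top}+\mathbf E^{(k)}\in\mathbb R^{T_k\times N}$, $k\in[K]$, with $r_k$ factors. $\lambda_j(\cdot)$ is the $j$-th largest eigenvalue, $\|\cdot\|$ spectral norm, $\|\cdot\|_{\max}$ max entry, $M$ finite constant, $a\wedge b=\min$, $a\vee b=\max$. Assumptions.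 (A1) For all $k\in\{0\}\cup[K]$: $E\|\mathbf f^{(k)}_t\|^4\le M$; $\mathbf F^{(k)\top}\mathbf F^{(k)}/T_k\to\boldsymbol\Sigma^{(k)}_F$ in probability as $T_k\to\infty$, positive definite with bounded distinct eigenvalues. (A2) $\|\boldsymbol\Lambda^{(k)}\|_{\max}\le M$; $\|\mathbf D^{-1/2}\boldsymbol\Lambda^{(0)\top}\boldsymbol\Lambda^{(0)}\mathbf D^{-1/2}-\mathbf I_{r_0}\|\to0$ where $\mathbf D=\mathrm{diag}(\mathbf D_s,\mathbf D_w)$ is diagonal, $(\mathbf D_s)_{ii}\asymp N$ ($i\in[r_0-s]$), $(\mathbf D_w)_{ii}\asymp N^{\alpha_i}$ ($i\in[s]$), $0<\alpha_s\le\dots\le\alpha_1<1$; $\|N^{-1}\boldsymbol\Lambda^{(k)\top}\boldsymbol\Lambda^{(k)}-\mathbf I_{r_k}\|\to0$, $k\in[K]$. (A3) $\|\mathbf E^{(k)}\|^2=O_p(N\vee T_k)$. (A4) For each $t$: $E\|\mathbf D^{-1/2}\sum_i\boldsymbol\Lambda^{(0)\top}_{i,\cdot}\epsilon^{(0)}_{ti}\|^2\le M$ and $E\|N^{-1/2}\sum_i\boldsymbol\Lambda^{(k)\top}_{i,\cdot}\epsilon^{(k)}_{ti}\|^2\le M$ ($k\in[K]$); for each $i$: $E\|T_k^{-1/2}\sum_t\mathbf f^{(k)}_t\epsilon^{(k)}_{ti}\|^2\le M$. (A6)(1) $N/(\sqrt{T_0}N^{\alpha_s})\to0$. (A7) For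 some finite constant $C>0$ and some $c\in(0,1]$, $\lambda_{\lfloor c(N\wedge T_0)\rfloor}\big(\mathbf E^{(0)\top}\mathbf E^{(0)}/(N\vee T_0)\big)\ge C+o_p(1)$. *)

theory Defs imports "HOL-Probability.Probability" "Jordan_Normal_Form.Char_Poly" begin

(* Eigenvalues of a real square matrix, with algebraic multiplicity: the roots
   of the characteristic polynomial.  For the real symmetric matrices used below
   the characteristic polynomial splits over the reals. *)
definition eig_mset :: "real mat \<Rightarrow> real multiset" where
  "eig_mset A = Abs_multiset (\<lambda>x. order x (char_poly A))"

definition eig :: "nat \<Rightarrow> real mat \<Rightarrow> real" where
  "eig j A = rev (sorted_list_of_multiset (eig_mset A)) ! (j - 1)"

definition vnorm :: "real vec \<Rightarrow> real" where
  "vnorm v = sqrt (\<Sum>i<dim_vec v. (v $ i)\<^sup>2)"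

definition spec_norm :: "real mat \<Rightarrow> real" where
  "spec_norm A = Sup {vnorm (A *\<^sub>v v) | v. v \<in> carrier_vec (dim_col A) \<and> vnorm v = 1}"

definition diag_mat :: "nat \<Rightarrow> (nat \<Rightarrow> real) \<Rightarrow> real mat" where
  "diag_mat r d = mat r r (\<lambda>(i,j). if i = j then d i else 0)"

definition sym_pos_def :: "real mat \<Rightarrow> nat \<Rightarrow> bool" where
  "sym_pos_def S r \<longleftrightarrow> S \<in> carrier_mat r r \<and> transpose_mat S = S \<and>
     (\<forall>v \<in> carrier_vec r. v \<noteq> 0\<^sub>v r \<longrightarrow> v \<bullet> (S *\<^sub>v v) > 0)"

context prob_space
begin

definition conv_in_prob_mat :: "(nat \<Rightarrow> 'a \<Rightarrow> real mat) \<Rightarrow> real mat \<Rightarrow> bool" where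
  "conv_in_prob_mat A B \<longleftrightarrow>
     (\<forall>\<epsilon>>0. (\<lambda>n. prob {\<omega> \<in> space M. spec_norm (A n \<omega> - B) > \<epsilon>}) \<longlonglongrightarrow> 0)"

definition bigO_p :: "(nat \<Rightarrow> 'a \<Rightarrow> real) \<Rightarrow> (nat \<Rightarrow> real) \<Rightarrow> bool" where
  "bigO_p Z a \<longleftrightarrow>
     (\<forall>\<epsilon>>0. \<exists>C. \<exists>n0. \<forall>n\<ge>n0. prob {\<omega> \<in> space M. \<bar>Z n \<omega>\<bar> > C * a n} < \<epsilon>)"

definition ge_plus_o_p :: "(nat \<Rightarrow> 'a \<Rightarrow> real) \<Rightarrow> real \<Rightarrow> bool" where
  "ge_plus_o_p Z C \<longleftrightarrow>
     (\<forall>\<epsilon>>0. (\<lambda>n. prob {\<omega> \<in> space M. Z n \<omega> < C - \<epsilon>}) \<longlonglongrightarrow> 0)"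

end

end

(* Write X = F L^T + E with F of size T x r.  By the Courant-Fischer principle, X^T X / T has its
   r-th eigenvalue at least of order N^alpha_s (restrict the quadratic form to the range of L,
   where the noise is negligible) and its first at most of order N.  On the kernel of L^T, a
   subspace of codimension at most r, X coincides with E; hence the (r+1)-st eigenvalue is at most
   ||E||^2 / T, and the j-th is at least the (j+r)-th eigenvalue of E^T E / T.  With
   rho = max(N,T)/T the ratio at r is therefore at least of order N^alpha_s / rho, the earlier ratios
   are at most of order N^(1-alpha_s), and the later ones are bounded.  The ratio at r wins because
   N^(1-2 alpha_s) rho tends to 0, which is where alpha_s > 1/2 and (A6)(1) enter. *)
theory Submission imports Defs "Jordan_Normal_Form.Schur_Decomposition" begin

unbundle no inner_syntax and no vec_syntax

text \<open>The obstacle is \<open>eig\<close>, which only counts roots of the characteristic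
  polynomial and says nothing about quadratic forms. Realness of the roots and an orthonormal
  eigenbasis bridge the gap; afterwards eigenvalues are reached through two one-sided tests, each a
  dimension count that produces one nonzero vector common to two subspaces. The same tests show that
  eigenvalues are Lipschitz in the entries, hence random variables. The probabilistic content is
  confined to three scalars: the distance of the factor Gram matrix to its limit, the squared noise
  norm, and one noise eigenvalue. Once these are controlled, the comparison of ratios is
  deterministic. All ratios are compared with a single threshold a / b, where a lies below the r-th
  and b above the (r+1)-st eigenvalue. Late ratios stay bounded even if N / T diverges because b and
  the lower bound g on the last eigenvalue share the factor rho. The last ratio reads eigenvalue
  \<open>rmax n + 1\<close>, and passing to the noise costs \<open>r0\<close> further positions,
  which is exactly the room left by the upper bound on \<open>rmax\<close>.\<close>

section \<open>Linear algebra preliminaries\<close>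

text \<open>Stacking the rows of both systems and padding with zero rows gives a square singular
  matrix; row \<open>k + l\<close> is certainly zero and exists because k + l < m. Two systems are
  allowed because several uses impose two unrelated families of constraints at once; an absent
  family is a matrix with 0 rows.\<close>

lemma homogeneous_system_nontrivial:
  fixes G :: "'a :: field mat"
  assumes G: "G \<in> carrier_mat k m" and H: "H \<in> carrier_mat l m" and km: "k + l < m"
  obtains u where "u \<in> carrier_vec m" "u \<noteq> 0\<^sub>v m" "G *\<^sub>v u = 0\<^sub>v k" "H *\<^sub>v u = 0\<^sub>v l"
proof -
  define c where "c i = (if i < k then row G i else if i < k + l then row H (i - k) else 0\<^sub>v m)" for i
  define S where "S = mat\<^sub>r m m (\<lambda>i. if i = k + l then 0\<^sub>v m else c i)"
  have "det S = 0" unfolding S_def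
    by (rule det_row_0) (use km G H in \<open>auto simp: c_def\<close>)
  moreover have S: "S \<in> carrier_mat m m" by (simp add: S_def)
  ultimately obtain u where u: "u \<in> carrier_vec m" "u \<noteq> 0\<^sub>v m" "S *\<^sub>v u = 0\<^sub>v m"
    using det_0_iff_vec_prod_zero by blast
  have c0: "c i \<bullet> u = 0" if "i < k + l" for i
  proof -
    have "(S *\<^sub>v u) $ i = row S i \<bullet> u" using S that km by simp
    moreover have "row S i = c i" unfolding S_def using that km G H
      by (subst row_mat_of_row_fun) (auto simp: c_def)
    ultimately show ?thesis using u that km by simp
  qed
  have "G *\<^sub>v u = 0\<^sub>v k"
  proof (intro eq_vecI)
    fix i assume "i < dim_vec (0\<^sub>v k :: 'a vec)"
    then have i: "i < k" by simp
    then show "(G *\<^sub>v u) $ i = 0\<^sub>v k $ i" using c0[of i] G by (simp add: c_def)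
  qed (use G in simp)
  moreover have "H *\<^sub>v u = 0\<^sub>v l"
  proof (intro eq_vecI)
    fix i assume "i < dim_vec (0\<^sub>v l :: 'a vec)"
    then have i: "i < l" by simp
    then show "(H *\<^sub>v u) $ i = 0\<^sub>v l $ i" using c0[of "k + i"] H by (simp add: c_def)
  qed (use H in simp)
  ultimately show ?thesis using that u by blast
qed

lemma scalar_prod_mult_mat_vec:
  fixes A :: "'a :: comm_semiring_0 mat"
  assumes "A \<in> carrier_mat m n" "u \<in> carrier_vec m" "v \<in> carrier_vec n"
  shows "u \<bullet> (A *\<^sub>v v) = (transpose_mat A *\<^sub>v u) \<bullet> v"
proof -
  have "u \<bullet> (A *\<^sub>v v) = (\<Sum>i<m. \<Sum>j<n. u $ i * (A $$ (i,j) * v $ j))"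
    using assms by (simp add: scalar_prod_def sum_distrib_left lessThan_atLeast0)
  also have "\<dots> = (\<Sum>j<n. \<Sum>i<m. u $ i * (A $$ (i,j) * v $ j))" by (rule sum.swap)
  also have "\<dots> = (transpose_mat A *\<^sub>v u) \<bullet> v"
    using assms by (simp add: scalar_prod_def sum_distrib_left lessThan_atLeast0 ac_simps)
  finally show ?thesis .
qed

lemma scalar_prod_self_sum: "v \<bullet> v = (\<Sum>i<dim_vec v. (v $ i)\<^sup>2)" for v :: "real vec"
  by (simp add: scalar_prod_def lessThan_atLeast0 power2_eq_square)

lemma scalar_prod_self_nonneg: "v \<bullet> v \<ge> 0" for v :: "real vec"
  by (simp add: scalar_prod_self_sum sum_nonneg)

lemma scalar_prod_self_pos:
  fixes v :: "real vec"
  assumes "v \<in> carrier_vec n" "v \<noteq> 0\<^sub>v n"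
  shows "v \<bullet> v > 0"
proof -
  obtain i where i: "i < n" "v $ i \<noteq> 0"
    using assms by (metis carrier_vecD eq_vecI index_zero_vec)
  have "0 < (\<Sum>i<n. (v $ i)\<^sup>2)"
    by (rule sum_pos2[of _ i]) (use i in auto)
  then show ?thesis using assms by (simp add: scalar_prod_self_sum)
qed

section \<open>The spectral theorem for real symmetric matrices\<close>

lemma mult_mat_vec_index_sum:
  assumes "A \<in> carrier_mat m n" "v \<in> carrier_vec n" "i < m"
  shows "(A *\<^sub>v v) $ i = (\<Sum>j<n. A $$ (i,j) * v $ j)"
  using assms by (simp add: scalar_prod_def lessThan_atLeast0)

text \<open>Over the complex numbers the polynomial splits. For a root a with eigenvector z, the
  Hermitian form \<open>R\<close> of z equals a ||z||^2 and is its own conjugate by symmetry, so a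
  is real; injectivity of the coefficient embedding brings the factorization back to the
  reals.\<close>

lemma symmetric_char_poly_splits:
  fixes A :: "real mat"
  assumes A: "A \<in> carrier_mat n n" and sym: "transpose_mat A = A"
  obtains es where "char_poly A = (\<Prod>e\<leftarrow>es. [:- e, 1:])" "length es = n"
proof -
  define cA where "cA = map_mat complex_of_real A"
  have cA: "cA \<in> carrier_mat n n" using A by (simp add: cA_def)
  obtain as where as: "char_poly cA = (\<Prod>a\<leftarrow>as. [:- a, 1:])" "length as = n"
    using char_poly_factorized[OF cA] by blast
  have real: "a \<in> \<real>" if "a \<in> set as" for a
  proof -
    have "poly (char_poly cA) a = 0"
      unfolding as(1) using that by (simp add: poly_prod_list prod_list_zero_iff image_iff) 
    then have "eigenvalue cA a" using eigenvalue_root_char_poly[OF cA] by simp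
    then obtain z where z: "z \<in> carrier_vec n" "z \<noteq> 0\<^sub>v n" "cA *\<^sub>v z = a \<cdot>\<^sub>v z"
      using cA unfolding eigenvalue_def eigenvector_def by auto
    obtain k where k: "k < n" "z $ k \<noteq> 0"
      using z by (metis carrier_vecD eq_vecI index_zero_vec)
    define S where "S = (\<Sum>i<n. (cmod (z $ i))\<^sup>2)"
    have Spos: "S > 0" unfolding S_def
      by (rule sum_pos2[of _ k]) (use k in auto)
    define R where "R = (\<Sum>i<n. \<Sum>j<n. cnj (z $ i) * of_real (A $$ (i,j)) * z $ j)"
    have "R = (\<Sum>i<n. cnj (z $ i) * (cA *\<^sub>v z) $ i)"
      using A z(1) unfolding R_def
      by (intro sum.cong refl, subst mult_mat_vec_index_sum[OF cA z(1)])
         (auto simp: cA_def sum_distrib_left mult.assoc)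
    also have "\<dots> = (\<Sum>i<n. a * of_real ((cmod (z $ i))\<^sup>2))"
      using z by (intro sum.cong refl) (simp add: complex_norm_square mult_ac del: of_real_power)
    finally have R1: "R = a * of_real S"
      by (simp add: S_def sum_distrib_left)
    have symij: "A $$ (i,j) = A $$ (j,i)" if "i < n" "j < n" for i j
      using sym A that by (metis carrier_matD index_transpose_mat(1))
    have "cnj R = (\<Sum>i<n. \<Sum>j<n. z $ i * of_real (A $$ (i,j)) * cnj (z $ j))"
      by (simp add: R_def cnj_sum)
    also have "\<dots> = (\<Sum>j<n. \<Sum>i<n. z $ i * of_real (A $$ (i,j)) * cnj (z $ j))"
      by (rule sum.swap)
    also have "\<dots> = R" unfolding R_def
      by (intro sum.cong refl) (use symij in \<open>auto simp: mult_ac\<close>)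
    finally have "R \<in> \<real>" by (simp add: Reals_cnj_iff)
    moreover have "a = R / of_real S" using R1 Spos by simp
    ultimately show ?thesis by simp
  qed
  define es where "es = map Re as"
  have as_es: "as = map complex_of_real es"
    unfolding es_def map_map by (rule map_idI[symmetric]) (use real in auto)
  have "map_poly complex_of_real (char_poly A) = char_poly cA"
    unfolding cA_def by (rule of_real_hom.char_poly_hom[OF A, symmetric])
  also have "\<dots> = map_poly complex_of_real (\<Prod>e\<leftarrow>es. [:- e, 1:])"
  proof -
    interpret h: map_poly_inj_idom_hom "of_real :: real \<Rightarrow> complex" ..
    show ?thesis unfolding as(1) as_es h.hom_prod_list by (simp add: o_def)
  qed
  finally have "char_poly A = (\<Prod>e\<leftarrow>es. [:- e, 1:])"
  proof -
    interpret h: map_poly_inj_idom_hom "of_real :: real \<Rightarrow> complex" ..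
    show "map_poly complex_of_real (char_poly A) = map_poly complex_of_real (\<Prod>e\<leftarrow>es. [:- e, 1:]) \<Longrightarrow> ?thesis"
      by (rule h.injectivity)
  qed
  moreover have "length es = n" using as(2) by (simp add: es_def)
  ultimately show ?thesis using that by blast
qed

text \<open>\<open>Abs_multiset\<close> is meaningful only on functions of finite support; the
  splitting exhibits the multiplicity function as \<open>count (mset es)\<close>.\<close>

lemma eig_mset_split:
  assumes "char_poly A = (\<Prod>e\<leftarrow>es. [:- e, 1:])"
  shows "eig_mset A = mset es"
proof -
  have "Polynomial.order x (\<Prod>e\<leftarrow>es. [:- e, 1:]) = count (mset es) x" for x
  proof (induction es)
    case (Cons e es)
    have "(\<Prod>e\<leftarrow>es. [:- e, 1:]) \<noteq> 0"
      by (auto simp: prod_list_zero_iff)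
    then have "Polynomial.order x (\<Prod>e\<leftarrow>e # es. [:- e, 1:]) = Polynomial.order x [:- e, 1:] + Polynomial.order x (\<Prod>e\<leftarrow>es. [:- e, 1:])"
      by (simp add: order_mult del: mult_pCons_left)
    then show ?case using Cons.IH by (simp add: order_linear')
  qed simp
  then show ?thesis unfolding eig_mset_def assms by (simp add: count_inverse)
qed

text \<open>The factors may be permuted, so the decreasing order used by \<open>eig\<close> can be
  imposed on the list. Positions in \<open>es\<close> start at 0 and indices of \<open>eig\<close>
  at 1.\<close>

lemma symmetric_eig_list:
  fixes A :: "real mat"
  assumes A: "A \<in> carrier_mat n n" and sym: "transpose_mat A = A"
  obtains es where "char_poly A = (\<Prod>e\<leftarrow>es. [:- e, 1:])" "length es = n"
    "sorted (rev es)" "\<And>j. eig j A = es ! (j - 1)"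
proof -
  obtain es0 where es0: "char_poly A = (\<Prod>e\<leftarrow>es0. [:- e, 1:])" "length es0 = n"
    using symmetric_char_poly_splits[OF A sym] .
  define es where "es = rev (sorted_list_of_multiset (mset es0))"
  have m: "mset es = mset es0" by (simp add: es_def)
  have "(\<Prod>e\<leftarrow>es. [:- e, 1:]) = prod_mset (image_mset (\<lambda>e. [:- e, 1:]) (mset es))"
    by (simp add: prod_mset_prod_list[symmetric] del: prod_mset_prod_list)
  also have "\<dots> = (\<Prod>e\<leftarrow>es0. [:- e, 1:])"
    unfolding m by (simp add: prod_mset_prod_list[symmetric] del: prod_mset_prod_list)
  finally have "char_poly A = (\<Prod>e\<leftarrow>es. [:- e, 1:])" using es0(1) by simp
  moreover have "length es = n" using m es0(2) by (metis size_mset)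
  moreover have "sorted (rev es)" by (simp add: es_def)
  moreover have "eig j A = es ! (j - 1)" for j
    by (simp add: eig_def eig_mset_split[OF es0(1)] es_def)
  ultimately show ?thesis using that by blast
qed

lemma eig_antimono:
  fixes A :: "real mat"
  assumes A: "A \<in> carrier_mat n n" and sym: "transpose_mat A = A"
    and ij: "1 \<le> i" "i \<le> j" "j \<le> n"
  shows "eig j A \<le> eig i A"
proof -
  obtain es where es: "length es = n" "sorted (rev es)" "\<And>j. eig j A = es ! (j - 1)"
    using symmetric_eig_list[OF A sym] by metis
  show ?thesis unfolding es(3)
    by (rule sorted_rev_nth_mono[OF es(2)]) (use ij es(1) in auto)
qed

text \<open>A Schur decomposition \<open>A P = P B\<close> need not be orthogonal, but the spans \<open>V k\<close> of the first
  \<open>k\<close> columns of \<open>P\<close> are invariant under \<open>A\<close>. A vector \<open>v\<close> in \<open>V (Suc k)\<close> orthogonal to \<open>V k\<close>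
  is an eigenvector: \<open>w = A v - es ! k v\<close> lies in \<open>V k\<close>, so by symmetry
  \<open>w \<bullet> w = (A w) \<bullet> v = 0\<close>.\<close>

lemma symmetric_eigenbasis:
  fixes A :: "real mat"
  assumes A: "A \<in> carrier_mat n n" and sym: "transpose_mat A = A"
    and cp: "char_poly A = (\<Prod>e\<leftarrow>es. [:- e, 1:])" and len: "length es = n"
  obtains q where "\<And>i. i < n \<Longrightarrow> q i \<in> carrier_vec n"
    "\<And>i. i < n \<Longrightarrow> A *\<^sub>v q i = es ! i \<cdot>\<^sub>v q i"
    "\<And>i j. i < n \<Longrightarrow> j < n \<Longrightarrow> q i \<bullet> q j = (if i = j then 1 else 0)"
proof -
  obtain B P Q where BPQ: "schur_decomposition A es = (B,P,Q)" by (cases "schur_decomposition A es")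
  have sd: "similar_mat_wit A B P Q" "upper_triangular B" "Matrix.diag_mat B = es"
    using schur_decomposition[OF A cp BPQ] by auto
  have carr: "B \<in> carrier_mat n n" "P \<in> carrier_mat n n" "Q \<in> carrier_mat n n"
    and QP: "Q * P = 1\<^sub>m n" and APBQ: "A = P * B * Q"
    using sd(1) A unfolding similar_mat_wit_def Let_def by auto
  have AP: "A * P = P * B"
    unfolding APBQ using carr QP by (metis assoc_mult_mat mult_carrier_mat right_mult_one_mat)
  have Bdiag: "B $$ (i,i) = es ! i" if "i < n" for i
    using sd(3) that carr by (auto simp: Matrix.diag_mat_def)
  have Blow: "B $$ (i,j) = 0" if "j < i" "i < n" for i j
    using sd(2) that carr by (auto simp: upper_triangular_def)
  define V where "V k = {P *\<^sub>v c |c. c \<in> carrier_vec n \<and> (\<forall>i. k \<le> i \<longrightarrow> i < n \<longrightarrow> c $ i = 0)}" for k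
  have Vcarr: "w \<in> carrier_vec n" if "w \<in> V k" for w k
    using that carr by (auto simp: V_def)
  have Bc: "(B *\<^sub>v c) $ i = (\<Sum>j<n. B $$ (i,j) * c $ j)" if "c \<in> carrier_vec n" "i < n" for c i
    by (rule mult_mat_vec_index_sum[OF carr(1) that])
  have VA: "A *\<^sub>v w \<in> V k" if wV: "w \<in> V k" for w k
  proof -
    obtain c where c: "w = P *\<^sub>v c" "c \<in> carrier_vec n" "\<And>i. k \<le> i \<Longrightarrow> i < n \<Longrightarrow> c $ i = 0"
      using wV by (auto simp: V_def)
    have "A *\<^sub>v w = P *\<^sub>v (B *\<^sub>v c)"
      unfolding c(1) using A carr c(2) AP by (metis assoc_mult_mat_vec)
    moreover have "(B *\<^sub>v c) $ i = 0" if i: "k \<le> i" "i < n" for i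
      unfolding Bc[OF c(2) i(2)]
    proof (intro sum.neutral ballI)
      fix j assume "j \<in> {..<n}"
      then show "B $$ (i,j) * c $ j = 0"
        using Blow[of j i] c(3)[of j] i by (cases "j < i") auto
    qed
    moreover have "B *\<^sub>v c \<in> carrier_vec n" using carr c(2) by simp
    ultimately show ?thesis unfolding V_def by blast
  qed
  have ex: "\<exists>v. v \<in> V (Suc k) \<and> v \<noteq> 0\<^sub>v n \<and> (\<forall>w\<in>V k. w \<bullet> v = 0) \<and> A *\<^sub>v v = es ! k \<cdot>\<^sub>v v"
    if k: "k < n" for k
  proof -
    \<comment> \<open>\<open>G\<close> says that P u is orthogonal to the first k columns of
      \<open>P\<close>, \<open>H\<close> that the coordinates of u beyond k vanish. Together these
      are k + (n - 1 - k) = n - 1 equations in n unknowns, so a nonzero u exists.\<close>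
    define G where "G = mat k n (\<lambda>(i,l). (transpose_mat P * P) $$ (i,l))"
    define H where "H = mat (n - 1 - k) n (\<lambda>(i,l). if l = k + 1 + i then (1::real) else 0)"
    have PP: "transpose_mat P * P \<in> carrier_mat n n" using carr by simp
    have G: "G \<in> carrier_mat k n" and H: "H \<in> carrier_mat (n - 1 - k) n"
      by (auto simp: G_def H_def)
    obtain u where u: "u \<in> carrier_vec n" "u \<noteq> 0\<^sub>v n" "G *\<^sub>v u = 0\<^sub>v k" "H *\<^sub>v u = 0\<^sub>v (n - 1 - k)"
      by (rule homogeneous_system_nontrivial[OF G H]) (use k in auto)
    have u0: "u $ l = 0" if l: "k < l" "l < n" for l
    proof -
      have "0 = (H *\<^sub>v u) $ (l - k - 1)" using u(4) l by simp
      also have "\<dots> = (\<Sum>j<n. H $$ (l - k - 1, j) * u $ j)"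
        by (rule mult_mat_vec_index_sum[OF H u(1)]) (use l in auto)
      also have "\<dots> = (\<Sum>j<n. if j = l then u $ j else 0)"
        by (intro sum.cong refl) (use l in \<open>auto simp: H_def\<close>)
      finally show ?thesis using l by simp
    qed
    have Gu: "((transpose_mat P * P) *\<^sub>v u) $ i = 0" if i: "i < k" for i
    proof -
      have "0 = (G *\<^sub>v u) $ i" using u(3) i by simp
      also have "\<dots> = (\<Sum>j<n. G $$ (i,j) * u $ j)"
        by (rule mult_mat_vec_index_sum[OF G u(1) i])
      also have "\<dots> = (\<Sum>j<n. (transpose_mat P * P) $$ (i,j) * u $ j)"
        by (intro sum.cong refl) (use i in \<open>simp add: G_def\<close>)
      also have "\<dots> = ((transpose_mat P * P) *\<^sub>v u) $ i"
        by (rule mult_mat_vec_index_sum[OF PP u(1), symmetric]) (use i k in auto)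
      finally show ?thesis by simp
    qed
    define v where "v = P *\<^sub>v u"
    have v: "v \<in> carrier_vec n" using carr u by (simp add: v_def)
    have vV: "v \<in> V (Suc k)" unfolding V_def v_def using u u0 by auto
    have "Q *\<^sub>v v = u" unfolding v_def using carr u QP
      by (metis assoc_mult_mat_vec one_mult_mat_vec)
    then have v0: "v \<noteq> 0\<^sub>v n" using u(2) carr by auto
    have orth: "w \<bullet> v = 0" if wV: "w \<in> V k" for w
    proof -
      obtain c where c: "w = P *\<^sub>v c" "c \<in> carrier_vec n" "\<And>i. k \<le> i \<Longrightarrow> i < n \<Longrightarrow> c $ i = 0"
        using wV by (auto simp: V_def)
      have "w \<bullet> v = v \<bullet> (P *\<^sub>v c)" using c v carr by (simp add: comm_scalar_prod[of _ n])
      also have "\<dots> = (transpose_mat P *\<^sub>v v) \<bullet> c"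
        by (rule scalar_prod_mult_mat_vec[OF carr(2) v c(2)])
      also have "transpose_mat P *\<^sub>v v = (transpose_mat P * P) *\<^sub>v u"
        unfolding v_def using carr u by simp
      also have "\<dots> \<bullet> c = (\<Sum>i<n. ((transpose_mat P * P) *\<^sub>v u) $ i * c $ i)"
        using c(2) by (simp add: scalar_prod_def lessThan_atLeast0)
      also have "\<dots> = 0"
      proof (intro sum.neutral ballI)
        fix i assume "i \<in> {..<n}"
        then show "((transpose_mat P * P) *\<^sub>v u) $ i * c $ i = 0"
          using Gu[of i] c(3)[of i] by (cases "i < k") auto
      qed
      finally show ?thesis .
    qed
    define w where "w = A *\<^sub>v v - es ! k \<cdot>\<^sub>v v"
    have wc: "w \<in> carrier_vec n" using A v by (simp add: w_def)
    have "w = P *\<^sub>v (B *\<^sub>v u - es ! k \<cdot>\<^sub>v u)"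
    proof -
      have "A *\<^sub>v v = P *\<^sub>v (B *\<^sub>v u)"
        unfolding v_def using A carr u(1) AP by (metis assoc_mult_mat_vec)
      moreover have "es ! k \<cdot>\<^sub>v v = P *\<^sub>v (es ! k \<cdot>\<^sub>v u)"
        unfolding v_def using carr u by (simp add: mult_mat_vec)
      ultimately show ?thesis unfolding w_def using carr u
        by (simp add: mult_minus_distrib_mat_vec[of _ n n])
    qed
    \<comment> \<open>From row k on, triangularity leaves only the diagonal entry, since the
      coordinates of u after k vanish; for i > k both terms are zero.\<close>
    moreover have "(B *\<^sub>v u - es ! k \<cdot>\<^sub>v u) $ i = 0" if i: "k \<le> i" "i < n" for i
    proof -
      have "(B *\<^sub>v u) $ i = (\<Sum>j<n. if j = i then es ! k * u $ i else 0)"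
        unfolding Bc[OF u(1) i(2)]
      proof (intro sum.cong refl)
        fix j assume "j \<in> {..<n}"
        then consider "j < i" | "j = i" | "i < j" "j < n" by force
        then show "B $$ (i,j) * u $ j = (if j = i then es ! k * u $ i else 0)"
          by cases (use Blow[of j i] u0[of j] u0[of i] Bdiag[of i] i in \<open>auto simp: le_less\<close>)
      qed
      then show ?thesis using i u carr by simp
    qed
    moreover have "B *\<^sub>v u - es ! k \<cdot>\<^sub>v u \<in> carrier_vec n" using carr u by simp
    ultimately have wV: "w \<in> V k" unfolding V_def by blast
    have "w \<bullet> w = w \<bullet> (A *\<^sub>v v) - es ! k * (w \<bullet> v)"
      unfolding w_def using A v by (simp add: scalar_prod_minus_distrib[of _ n])
    also have "w \<bullet> (A *\<^sub>v v) = (A *\<^sub>v w) \<bullet> v"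
      using scalar_prod_mult_mat_vec[OF A wc v] sym by simp
    also have "\<dots> = 0" by (rule orth[OF VA[OF wV]])
    also have "w \<bullet> v = 0" by (rule orth[OF wV])
    finally have "w = 0\<^sub>v n" using scalar_prod_self_pos[OF wc] by fastforce
    then have "A *\<^sub>v v = es ! k \<cdot>\<^sub>v v" unfolding w_def using A v
      by (intro eq_vecI) (auto dest!: arg_cong[of _ _ "\<lambda>x. x $ _"] simp: vec_eq_iff)
    then show ?thesis using vV v0 orth by blast
  qed
  then obtain v where v: "\<And>k. k < n \<Longrightarrow> v k \<in> V (Suc k)" "\<And>k. k < n \<Longrightarrow> v k \<noteq> 0\<^sub>v n"
    "\<And>k w. k < n \<Longrightarrow> w \<in> V k \<Longrightarrow> w \<bullet> v k = 0" "\<And>k. k < n \<Longrightarrow> A *\<^sub>v v k = es ! k \<cdot>\<^sub>v v k"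
    by metis
  have vc: "v k \<in> carrier_vec n" if "k < n" for k using v(1)[OF that] Vcarr by blast
  have vpos: "v k \<bullet> v k > 0" if "k < n" for k
    using scalar_prod_self_pos vc v(2) that by blast
  have lt: "v i \<bullet> v j = 0" if "i < j" "j < n" for i j
  proof -
    have "V (Suc i) \<subseteq> V j" using that unfolding V_def by fastforce
    then show ?thesis using v(1)[of i] v(3)[of j] that by auto
  qed
  have ne: "v i \<bullet> v j = 0" if "i \<noteq> j" "i < n" "j < n" for i j
    using lt[of i j] lt[of j i] that vc by (metis comm_scalar_prod linorder_neqE_nat)
  define q where "q k = (1 / sqrt (v k \<bullet> v k)) \<cdot>\<^sub>v v k" for k
  show ?thesis
  proof (rule that[of q])
    show "q i \<in> carrier_vec n" if "i < n" for i using vc[OF that] by (simp add: q_def)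
    show "A *\<^sub>v q i = es ! i \<cdot>\<^sub>v q i" if "i < n" for i
      using vc[OF that] A v(4)[OF that]
      by (simp add: q_def mult_mat_vec smult_smult_assoc mult.commute)
    show "q i \<bullet> q j = (if i = j then 1 else 0)" if "i < n" "j < n" for i j
      using vc[OF that(1)] vc[OF that(2)] ne[of i j] that vpos[of i]
      by (auto simp: q_def)
  qed
qed

text \<open>Both forms are diagonal in the same coordinates, which reduces min-max arguments to
  comparing the weights in one sum. Sums start at 0 and \<open>eig\<close> at 1, hence
  \<open>Suc i\<close>.\<close>

lemma symmetric_spectral:
  fixes A :: "real mat"
  assumes A: "A \<in> carrier_mat n n" and sym: "transpose_mat A = A"
  shows "\<exists>Q \<in> carrier_mat n n. transpose_mat Q * Q = 1\<^sub>m n \<and>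
    (\<forall>v \<in> carrier_vec n. v \<bullet> v = (\<Sum>i<n. ((transpose_mat Q *\<^sub>v v) $ i)\<^sup>2) \<and>
      v \<bullet> (A *\<^sub>v v) = (\<Sum>i<n. eig (Suc i) A * ((transpose_mat Q *\<^sub>v v) $ i)\<^sup>2))"
proof -
  obtain es where es: "char_poly A = (\<Prod>e\<leftarrow>es. [:- e, 1:])" "length es = n"
    "\<And>j. eig j A = es ! (j - 1)"
    using symmetric_eig_list[OF A sym] by metis
  obtain q where q: "\<And>i. i < n \<Longrightarrow> q i \<in> carrier_vec n"
    "\<And>i. i < n \<Longrightarrow> A *\<^sub>v q i = es ! i \<cdot>\<^sub>v q i"
    "\<And>i j. i < n \<Longrightarrow> j < n \<Longrightarrow> q i \<bullet> q j = (if i = j then 1 else 0)"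
    using symmetric_eigenbasis[OF A sym es(1,2)] by metis
  define Q where "Q = mat n n (\<lambda>(i,j). q j $ i)"
  have Q: "Q \<in> carrier_mat n n" by (simp add: Q_def)
  have QtQ: "transpose_mat Q * Q = 1\<^sub>m n"
  proof (intro eq_matI)
    fix i j assume "i < dim_row (1\<^sub>m n :: real mat)" "j < dim_col (1\<^sub>m n :: real mat)"
    then have ij: "i < n" "j < n" by auto
    have "col Q i = q i" if "i < n" for i
      using q(1)[OF that] that by (intro eq_vecI) (auto simp: Q_def)
    then show "(transpose_mat Q * Q) $$ (i,j) = 1\<^sub>m n $$ (i,j)"
      using ij Q q(3)[OF ij] by simp
  qed (use Q in auto)
  \<comment> \<open>A one-sided inverse of a square matrix is two-sided; this completeness of the
    eigenbasis is what Parseval needs.\<close>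
  have QQt: "Q * transpose_mat Q = 1\<^sub>m n"
    by (rule mat_mult_left_right_inverse[OF _ Q QtQ]) (use Q in simp)
  have Qv: "(transpose_mat Q *\<^sub>v v) $ i = q i \<bullet> v" if "i < n" "v \<in> carrier_vec n" for v i
  proof -
    have "row (transpose_mat Q) i = q i"
      using q(1)[OF that(1)] that by (intro eq_vecI) (auto simp: Q_def)
    then show ?thesis using that Q by simp
  qed
  have parseval: "u \<bullet> v = (\<Sum>i<n. (transpose_mat Q *\<^sub>v u) $ i * (transpose_mat Q *\<^sub>v v) $ i)"
    if uv: "u \<in> carrier_vec n" "v \<in> carrier_vec n" for u v
  proof -
    have c: "transpose_mat Q *\<^sub>v v \<in> carrier_vec n" using Q uv by simp
    have "v = Q *\<^sub>v (transpose_mat Q *\<^sub>v v)"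
      using QQt Q uv by (metis assoc_mult_mat_vec one_mult_mat_vec transpose_carrier_mat)
    then have "u \<bullet> v = (transpose_mat Q *\<^sub>v u) \<bullet> (transpose_mat Q *\<^sub>v v)"
      using scalar_prod_mult_mat_vec[OF Q uv(1) c] by simp
    then show ?thesis using Q uv by (simp add: scalar_prod_def lessThan_atLeast0)
  qed
  show ?thesis
  proof (intro bexI[OF _ Q] conjI ballI QtQ)
    show "v \<bullet> v = (\<Sum>i<n. ((transpose_mat Q *\<^sub>v v) $ i)\<^sup>2)" if "v \<in> carrier_vec n" for v
      using parseval[OF that that] by (simp add: power2_eq_square)
    show "v \<bullet> (A *\<^sub>v v) = (\<Sum>i<n. eig (Suc i) A * ((transpose_mat Q *\<^sub>v v) $ i)\<^sup>2)"
      if v: "v \<in> carrier_vec n" for v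
    proof -
      have Av: "A *\<^sub>v v \<in> carrier_vec n" using A v by simp
      have "q i \<bullet> (A *\<^sub>v v) = es ! i * (q i \<bullet> v)" if "i < n" for i
        using scalar_prod_mult_mat_vec[OF A q(1)[OF that] v] sym q(2)[OF that] q(1)[OF that] v
        by simp
      then have "(transpose_mat Q *\<^sub>v (A *\<^sub>v v)) $ i = es ! i * (transpose_mat Q *\<^sub>v v) $ i"
        if "i < n" for i
        using Qv[OF that v] Qv[OF that Av] that by simp
      then show ?thesis unfolding parseval[OF v Av]
        by (intro sum.cong refl) (simp add: es(3) power2_eq_square)
    qed
  qed
qed

section \<open>The Courant-Fischer principle and its consequences\<close>

text \<open>\<open>B\<close> collects the first j orthonormal eigenvectors: it is an isometry, and
  on its range only the weights from \<open>eig 1\<close> to \<open>eig j\<close> occur, the least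
  of which is \<open>eig j\<close>.\<close>

lemma eig_top_subspace:
  fixes A :: "real mat"
  assumes A: "A \<in> carrier_mat n n" and sym: "transpose_mat A = A" and j: "1 \<le> j" "j \<le> n"
  obtains B where "B \<in> carrier_mat n j"
    "\<And>u. u \<in> carrier_vec j \<Longrightarrow> (B *\<^sub>v u) \<bullet> (B *\<^sub>v u) = u \<bullet> u"
    "\<And>u. u \<in> carrier_vec j \<Longrightarrow> eig j A * (u \<bullet> u) \<le> (B *\<^sub>v u) \<bullet> (A *\<^sub>v (B *\<^sub>v u))"
proof -
  obtain Q where Q: "Q \<in> carrier_mat n n" "transpose_mat Q * Q = 1\<^sub>m n"
    "\<And>v. v \<in> carrier_vec n \<Longrightarrow> v \<bullet> v = (\<Sum>i<n. ((transpose_mat Q *\<^sub>v v) $ i)\<^sup>2)"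
    "\<And>v. v \<in> carrier_vec n \<Longrightarrow>
      v \<bullet> (A *\<^sub>v v) = (\<Sum>i<n. eig (Suc i) A * ((transpose_mat Q *\<^sub>v v) $ i)\<^sup>2)"
    using symmetric_spectral[OF A sym] by blast
  \<comment> \<open>\<open>E\<close> is the identity cut to its first j columns, so
    \<open>Q * E\<close> keeps the leading j columns of \<open>Q\<close>.\<close>
  define E where "E = mat n j (\<lambda>(i,l). if i = l then (1::real) else 0)"
  define B where "B = Q * E"
  have E: "E \<in> carrier_mat n j" by (simp add: E_def)
  have B: "B \<in> carrier_mat n j" using Q E by (simp add: B_def)
  have y: "(transpose_mat Q *\<^sub>v (B *\<^sub>v u)) $ i = (if i < j then u $ i else 0)"
    if u: "u \<in> carrier_vec j" and i: "i < n" for u i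
  proof -
    have "transpose_mat Q *\<^sub>v (B *\<^sub>v u) = transpose_mat Q *\<^sub>v (Q *\<^sub>v (E *\<^sub>v u))"
      unfolding B_def assoc_mult_mat_vec[OF Q(1) E u] ..
    also have "\<dots> = (transpose_mat Q * Q) *\<^sub>v (E *\<^sub>v u)"
      by (rule assoc_mult_mat_vec[of _ n n _ n, symmetric]) (use Q(1) E u in auto)
    also have "\<dots> = E *\<^sub>v u" using Q(2) E u by simp
    also have "\<dots> $ i = (\<Sum>l<j. E $$ (i,l) * u $ l)" by (rule mult_mat_vec_index_sum[OF E u i])
    also have "\<dots> = (\<Sum>l<j. if l = i then u $ l else 0)"
      by (intro sum.cong refl) (use i j in \<open>auto simp: E_def\<close>)
    finally show ?thesis by simp
  qed
  have sum_eq: "(\<Sum>i<n. c i * ((transpose_mat Q *\<^sub>v (B *\<^sub>v u)) $ i)\<^sup>2) = (\<Sum>i<j. c i * (u $ i)\<^sup>2)"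
    if u: "u \<in> carrier_vec j" for u and c :: "nat \<Rightarrow> real"
  proof (rule sum.mono_neutral_cong_right)
    show "\<forall>i\<in>{..<n} - {..<j}. c i * ((transpose_mat Q *\<^sub>v (B *\<^sub>v u)) $ i)\<^sup>2 = 0"
      by (intro ballI) (simp add: y[OF u])
    show "c i * ((transpose_mat Q *\<^sub>v (B *\<^sub>v u)) $ i)\<^sup>2 = c i * (u $ i)\<^sup>2" if "i \<in> {..<j}" for i
      using that j by (simp add: y[OF u])
  qed (use j in auto)
  have uu: "u \<bullet> u = (\<Sum>i<j. (u $ i)\<^sup>2)" if "u \<in> carrier_vec j" for u :: "real vec"
    using that by (simp add: scalar_prod_self_sum)
  show ?thesis
  proof (rule that[OF B])
    fix u :: "real vec" assume u: "u \<in> carrier_vec j"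
    then have Bu: "B *\<^sub>v u \<in> carrier_vec n" using B by simp
    show "(B *\<^sub>v u) \<bullet> (B *\<^sub>v u) = u \<bullet> u"
      using Q(3)[OF Bu] sum_eq[OF u, of "\<lambda>_. 1"] uu[OF u] by simp
    have "eig j A * (u \<bullet> u) = (\<Sum>i<j. eig j A * (u $ i)\<^sup>2)"
      by (simp add: uu[OF u] sum_distrib_left)
    also have "\<dots> \<le> (\<Sum>i<j. eig (Suc i) A * (u $ i)\<^sup>2)"
      by (intro sum_mono mult_right_mono) (use eig_antimono[OF A sym] j in auto)
    also have "\<dots> = (B *\<^sub>v u) \<bullet> (A *\<^sub>v (B *\<^sub>v u))"
      unfolding Q(4)[OF Bu] sum_eq[OF u] ..
    finally show "eig j A * (u \<bullet> u) \<le> (B *\<^sub>v u) \<bullet> (A *\<^sub>v (B *\<^sub>v u))" .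
  qed
qed

text \<open>Fewer than j linear constraints cannot exclude the whole j-dimensional leading
  eigenspace. At a nonzero survivor the form is at least \<open>eig j A\<close> times and at most
  \<open>a\<close> times the squared norm.\<close>

lemma eig_le_if_constraints:
  fixes A :: "real mat"
  assumes A: "A \<in> carrier_mat n n" and sym: "transpose_mat A = A"
    and G: "G \<in> carrier_mat k n" and kj: "k < j" "j \<le> n"
    and le: "\<And>v. v \<in> carrier_vec n \<Longrightarrow> G *\<^sub>v v = 0\<^sub>v k \<Longrightarrow> v \<bullet> (A *\<^sub>v v) \<le> a * (v \<bullet> v)"
  shows "eig j A \<le> a"
proof -
  have "1 \<le> j" using kj by simp
  then obtain B where B: "B \<in> carrier_mat n j"
    "\<And>u. u \<in> carrier_vec j \<Longrightarrow> (B *\<^sub>v u) \<bullet> (B *\<^sub>v u) = u \<bullet> u"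
    "\<And>u. u \<in> carrier_vec j \<Longrightarrow> eig j A * (u \<bullet> u) \<le> (B *\<^sub>v u) \<bullet> (A *\<^sub>v (B *\<^sub>v u))"
    using eig_top_subspace[OF A sym] kj(2) by blast
  have GB: "G * B \<in> carrier_mat k j" using G B by simp
  obtain u where u: "u \<in> carrier_vec j" "u \<noteq> 0\<^sub>v j" "(G * B) *\<^sub>v u = 0\<^sub>v k"
    by (rule homogeneous_system_nontrivial[OF GB zero_carrier_mat[of 0 j]]) (use kj in auto)
  have "G *\<^sub>v (B *\<^sub>v u) = 0\<^sub>v k" using u G B by simp
  then have "(B *\<^sub>v u) \<bullet> (A *\<^sub>v (B *\<^sub>v u)) \<le> a * (u \<bullet> u)"
    using le[of "B *\<^sub>v u"] B(1) u(1) by (simp add: B(2)[OF u(1)])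
  then have "eig j A * (u \<bullet> u) \<le> a * (u \<bullet> u)" using B(3)[OF u(1)] by linarith
  then show ?thesis using scalar_prod_self_pos[OF u(1,2)] by simp
qed

text \<open>The range of \<open>B\<close> cut by \<open>G\<close> has dimension at least m - k, and
  orthogonality to j - 1 leading eigenvectors costs j - 1 more, so a nonzero vector remains; there
  the form is at most \<open>eig j A\<close> times the squared norm. Allowing both \<open>B\<close>
  and \<open>G\<close> covers the range of the loadings without constraints as well as a noise
  eigenspace cut by the kernel of the transposed loadings.\<close>

lemma eig_ge_if_subspace:
  fixes A :: "real mat"
  assumes A: "A \<in> carrier_mat n n" and sym: "transpose_mat A = A"
    and B: "B \<in> carrier_mat n m" and G: "G \<in> carrier_mat k n"
    and j: "1 \<le> j" "j \<le> n" "j + k \<le> m"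
    and inj: "\<And>u. u \<in> carrier_vec m \<Longrightarrow> u \<noteq> 0\<^sub>v m \<Longrightarrow> G *\<^sub>v (B *\<^sub>v u) = 0\<^sub>v k \<Longrightarrow> B *\<^sub>v u \<noteq> 0\<^sub>v n"
    and ge: "\<And>u. u \<in> carrier_vec m \<Longrightarrow> G *\<^sub>v (B *\<^sub>v u) = 0\<^sub>v k \<Longrightarrow>
      a * ((B *\<^sub>v u) \<bullet> (B *\<^sub>v u)) \<le> (B *\<^sub>v u) \<bullet> (A *\<^sub>v (B *\<^sub>v u))"
  shows "a \<le> eig j A"
proof -
  obtain Q where Q: "Q \<in> carrier_mat n n" and "transpose_mat Q * Q = 1\<^sub>m n"
    and Q': "\<And>v. v \<in> carrier_vec n \<Longrightarrow> v \<bullet> v = (\<Sum>i<n. ((transpose_mat Q *\<^sub>v v) $ i)\<^sup>2)"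
    "\<And>v. v \<in> carrier_vec n \<Longrightarrow>
      v \<bullet> (A *\<^sub>v v) = (\<Sum>i<n. eig (Suc i) A * ((transpose_mat Q *\<^sub>v v) $ i)\<^sup>2)"
    using symmetric_spectral[OF A sym] by blast
  \<comment> \<open>The rows of \<open>H\<close> are the j - 1 leading eigenvectors; a vector killed
    by \<open>H\<close> carries only the weights of index j and later.\<close>
  define H where "H = mat (j - 1) n (\<lambda>(i,l). Q $$ (l,i))"
  have H: "H \<in> carrier_mat (j - 1) n" by (simp add: H_def)
  have GB: "G * B \<in> carrier_mat k m" and HB: "H * B \<in> carrier_mat (j - 1) m"
    using G H B by auto
  obtain u where u: "u \<in> carrier_vec m" "u \<noteq> 0\<^sub>v m"
    "(G * B) *\<^sub>v u = 0\<^sub>v k" "(H * B) *\<^sub>v u = 0\<^sub>v (j - 1)"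
    by (rule homogeneous_system_nontrivial[OF GB HB]) (use j in auto)
  define v where "v = B *\<^sub>v u"
  have v: "v \<in> carrier_vec n" using B u by (simp add: v_def)
  have Gv: "G *\<^sub>v v = 0\<^sub>v k" and Hv: "H *\<^sub>v v = 0\<^sub>v (j - 1)"
    using u G H B by (auto simp: v_def)
  have y0: "(transpose_mat Q *\<^sub>v v) $ i = 0" if i: "i < j - 1" for i
  proof -
    have "(transpose_mat Q *\<^sub>v v) $ i = (\<Sum>l<n. transpose_mat Q $$ (i,l) * v $ l)"
      by (rule mult_mat_vec_index_sum[of _ n n]) (use Q v i j in auto)
    also have "\<dots> = (\<Sum>l<n. H $$ (i,l) * v $ l)"
      by (intro sum.cong refl) (use i j Q in \<open>auto simp: H_def\<close>)
    also have "\<dots> = (H *\<^sub>v v) $ i" by (rule mult_mat_vec_index_sum[OF H v i, symmetric])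
    finally show ?thesis using Hv i by simp
  qed
  have "a * (v \<bullet> v) \<le> v \<bullet> (A *\<^sub>v v)" using ge[OF u(1)] Gv by (simp add: v_def)
  also have "\<dots> \<le> (\<Sum>i<n. eig j A * ((transpose_mat Q *\<^sub>v v) $ i)\<^sup>2)"
    unfolding Q'(2)[OF v]
  proof (intro sum_mono)
    fix i assume "i \<in> {..<n}"
    then show "eig (Suc i) A * ((transpose_mat Q *\<^sub>v v) $ i)\<^sup>2 \<le> eig j A * ((transpose_mat Q *\<^sub>v v) $ i)\<^sup>2"
      using y0[of i] eig_antimono[OF A sym, of j "Suc i"] j
      by (cases "i < j - 1") (auto intro!: mult_right_mono)
  qed
  also have "\<dots> = eig j A * (v \<bullet> v)" unfolding Q'(1)[OF v] by (simp add: sum_distrib_left)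
  finally show ?thesis
    using scalar_prod_self_pos[OF v] inj[OF u(1,2)] Gv by (simp add: v_def)
qed

text \<open>One-sided Weyl inequality: the leading eigenspace of \<open>A\<close> is a test subspace
  for \<open>A'\<close>, on which the form loses at most \<delta>.\<close>

lemma eig_perturb:
  fixes A A' :: "real mat"
  assumes A: "A \<in> carrier_mat n n" "transpose_mat A = A"
    and A': "A' \<in> carrier_mat n n" "transpose_mat A' = A'"
    and j: "1 \<le> j" "j \<le> n"
    and le: "\<And>v. v \<in> carrier_vec n \<Longrightarrow> v \<bullet> (A *\<^sub>v v) \<le> v \<bullet> (A' *\<^sub>v v) + \<delta> * (v \<bullet> v)"
  shows "eig j A \<le> eig j A' + \<delta>"
proof -
  obtain B where B: "B \<in> carrier_mat n j"
    "\<And>u. u \<in> carrier_vec j \<Longrightarrow> (B *\<^sub>v u) \<bullet> (B *\<^sub>v u) = u \<bullet> u"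
    "\<And>u. u \<in> carrier_vec j \<Longrightarrow> eig j A * (u \<bullet> u) \<le> (B *\<^sub>v u) \<bullet> (A *\<^sub>v (B *\<^sub>v u))"
    using eig_top_subspace[OF A j] by metis
  have "eig j A - \<delta> \<le> eig j A'"
  proof (rule eig_ge_if_subspace[OF A' B(1) zero_carrier_mat[of 0 n] j])
    fix u :: "real vec" assume u: "u \<in> carrier_vec j"
    have "B *\<^sub>v u \<in> carrier_vec n" using B u by simp
    from le[OF this] show "(eig j A - \<delta>) * ((B *\<^sub>v u) \<bullet> (B *\<^sub>v u)) \<le> (B *\<^sub>v u) \<bullet> (A' *\<^sub>v (B *\<^sub>v u))"
      using B(3)[OF u] by (simp add: B(2)[OF u] algebra_simps)
    assume "u \<noteq> 0\<^sub>v j"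
    then have "(B *\<^sub>v u) \<bullet> (B *\<^sub>v u) > 0" using B(2)[OF u] scalar_prod_self_pos[OF u] by simp
    then show "B *\<^sub>v u \<noteq> 0\<^sub>v n" by auto
  qed auto
  then show ?thesis by simp
qed

lemma vec_index_le_norm:
  fixes v :: "real vec"
  assumes "i < dim_vec v"
  shows "\<bar>v $ i\<bar> \<le> sqrt (v \<bullet> v)"
  unfolding scalar_prod_self_sum
  by (rule real_le_rsqrt) (use member_le_sum[of i "{..<dim_vec v}" "\<lambda>i. (v $ i)\<^sup>2"] assms in simp)

lemma quadratic_form_le:
  fixes D :: "real mat"
  assumes D: "D \<in> carrier_mat n n" and v: "v \<in> carrier_vec n"
  shows "v \<bullet> (D *\<^sub>v v) \<le> (\<Sum>i<n. \<Sum>j<n. \<bar>D $$ (i,j)\<bar>) * (v \<bullet> v)"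
proof -
  have "v \<bullet> (D *\<^sub>v v) = (\<Sum>i<n. \<Sum>j<n. v $ i * (D $$ (i,j) * v $ j))"
    using D v by (simp add: scalar_prod_def sum_distrib_left lessThan_atLeast0)
  also have "\<dots> \<le> (\<Sum>i<n. \<Sum>j<n. \<bar>D $$ (i,j)\<bar> * (v \<bullet> v))"
  proof (intro sum_mono)
    fix i j assume ij: "i \<in> {..<n}" "j \<in> {..<n}"
    have "v $ i * (D $$ (i,j) * v $ j) \<le> \<bar>D $$ (i,j)\<bar> * (\<bar>v $ i\<bar> * \<bar>v $ j\<bar>)"
      by (metis abs_ge_self abs_mult mult.left_commute)
    also have "\<bar>v $ i\<bar> * \<bar>v $ j\<bar> \<le> sqrt (v \<bullet> v) * sqrt (v \<bullet> v)"
      by (intro mult_mono vec_index_le_norm) (use ij v scalar_prod_self_nonneg in auto)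
    also have "\<dots> = v \<bullet> v" using scalar_prod_self_nonneg by simp
    finally show "v $ i * (D $$ (i,j) * v $ j) \<le> \<bar>D $$ (i,j)\<bar> * (v \<bullet> v)"
      by (simp add: mult_left_mono)
  qed
  finally show ?thesis by (simp add: sum_distrib_right)
qed

text \<open>This continuity serves measurability only, so the crude sum over entries is good enough
  as a modulus.\<close>

lemma eig_diff_le_sum_entries:
  fixes A A' :: "real mat"
  assumes A: "A \<in> carrier_mat n n" "transpose_mat A = A"
    and A': "A' \<in> carrier_mat n n" "transpose_mat A' = A'"
    and j: "1 \<le> j" "j \<le> n"
  shows "\<bar>eig j A - eig j A'\<bar> \<le> (\<Sum>i<n. \<Sum>l<n. \<bar>A $$ (i,l) - A' $$ (i,l)\<bar>)"
proof -
  have *: "eig j A \<le> eig j A' + (\<Sum>i<n. \<Sum>l<n. \<bar>A $$ (i,l) - A' $$ (i,l)\<bar>)"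
    if A: "A \<in> carrier_mat n n" "transpose_mat A = A"
      and A': "A' \<in> carrier_mat n n" "transpose_mat A' = A'" for A A' :: "real mat"
  proof (rule eig_perturb[OF A A' j])
    fix v :: "real vec" assume v: "v \<in> carrier_vec n"
    have eq: "A *\<^sub>v v = A' *\<^sub>v v + (A - A') *\<^sub>v v"
      using A(1) A'(1) v by (simp add: minus_mult_distrib_mat_vec) (intro eq_vecI, auto)
    have "v \<bullet> (A *\<^sub>v v) = v \<bullet> (A' *\<^sub>v v) + v \<bullet> ((A - A') *\<^sub>v v)"
      unfolding eq by (rule scalar_prod_add_distrib[of _ n]) (use A(1) A'(1) v in \<open>auto intro!: mult_mat_vec_carrier minus_carrier_mat\<close>)
    moreover have "v \<bullet> ((A - A') *\<^sub>v v) \<le> (\<Sum>i<n. \<Sum>l<n. \<bar>(A - A') $$ (i,l)\<bar>) * (v \<bullet> v)"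
      by (rule quadratic_form_le[OF _ v]) (use A A' in auto)
    moreover have "(\<Sum>i<n. \<Sum>l<n. \<bar>(A - A') $$ (i,l)\<bar>) = (\<Sum>i<n. \<Sum>l<n. \<bar>A $$ (i,l) - A' $$ (i,l)\<bar>)"
      by (intro sum.cong refl) (use A A' in auto)
    ultimately show "v \<bullet> (A *\<^sub>v v) \<le> v \<bullet> (A' *\<^sub>v v)
        + (\<Sum>i<n. \<Sum>l<n. \<bar>A $$ (i,l) - A' $$ (i,l)\<bar>) * (v \<bullet> v)"
      by simp
  qed
  show ?thesis
    using *[OF A A'] *[OF A' A] by (simp add: abs_le_iff abs_minus_commute)
qed

section \<open>Spectral norm and measurability\<close>

lemma vnorm_eq_sqrt: "vnorm v = sqrt (v \<bullet> v)"
  by (simp add: vnorm_def scalar_prod_self_sum)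

lemma vnorm_nonneg [simp]: "vnorm v \<ge> 0"
  by (simp add: vnorm_eq_sqrt scalar_prod_self_nonneg)

lemma vnorm_power2: "(vnorm v)\<^sup>2 = v \<bullet> v"
  by (simp add: vnorm_eq_sqrt scalar_prod_self_nonneg)

lemma vnorm_triangle:
  assumes "u \<in> carrier_vec n" "v \<in> carrier_vec n"
  shows "vnorm (u + v) \<le> vnorm u + vnorm v"
proof -
  have *: "vnorm w = L2_set (\<lambda>i. w $ i) {..<n}" if "w \<in> carrier_vec n" for w
    using that by (simp add: vnorm_def L2_set_def)
  have "vnorm (u + v) = L2_set (\<lambda>i. u $ i + v $ i) {..<n}"
    using assms by (subst *) (auto intro!: L2_set_cong)
  then show ?thesis using L2_set_triangle_ineq[of "\<lambda>i. u $ i" "\<lambda>i. v $ i" "{..<n}"]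
    by (simp add: * assms)
qed

lemma vnorm_smult: "vnorm (a \<cdot>\<^sub>v v) = \<bar>a\<bar> * vnorm v"
  by (simp add: vnorm_def power_mult_distrib sum_distrib_left[symmetric] real_sqrt_mult)

lemma vnorm_mult_le_sum_entries:
  assumes A: "A \<in> carrier_mat m n" and v: "v \<in> carrier_vec n"
  shows "vnorm (A *\<^sub>v v) \<le> (\<Sum>i<m. \<Sum>j<n. \<bar>A $$ (i,j)\<bar>) * vnorm v"
proof -
  have "vnorm (A *\<^sub>v v) = L2_set (\<lambda>i. (A *\<^sub>v v) $ i) {..<m}"
    using A by (simp add: vnorm_def L2_set_def)
  also have "\<dots> \<le> (\<Sum>i<m. \<bar>(A *\<^sub>v v) $ i\<bar>)" by (rule L2_set_le_sum_abs)
  also have "\<dots> \<le> (\<Sum>i<m. \<Sum>j<n. \<bar>A $$ (i,j)\<bar> * vnorm v)"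
  proof (intro sum_mono)
    fix i assume "i \<in> {..<m}"
    then have "\<bar>(A *\<^sub>v v) $ i\<bar> \<le> (\<Sum>j<n. \<bar>A $$ (i,j) * v $ j\<bar>)"
      using mult_mat_vec_index_sum[OF A v, of i] sum_abs[of "\<lambda>j. A $$ (i,j) * v $ j" "{..<n}"] by simp
    also have "\<dots> \<le> (\<Sum>j<n. \<bar>A $$ (i,j)\<bar> * vnorm v)"
      by (intro sum_mono)
        (use v vec_index_le_norm[of _ v] in \<open>auto simp: abs_mult vnorm_eq_sqrt intro!: mult_left_mono\<close>)
    finally show "\<bar>(A *\<^sub>v v) $ i\<bar> \<le> (\<Sum>j<n. \<bar>A $$ (i,j)\<bar> * vnorm v)" .
  qed
  finally show ?thesis by (simp add: sum_distrib_right)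
qed

text \<open>\<open>Sup\<close> bounds its set only if the set is bounded above, which the sum of
  absolute entries provides; homogeneity extends the bound from unit vectors to all nonzero
  ones.\<close>

lemma vnorm_mult_le_spec_norm:
  assumes A: "A \<in> carrier_mat m n" and v: "v \<in> carrier_vec n"
  shows "vnorm (A *\<^sub>v v) \<le> spec_norm A * vnorm v"
proof (cases "v = 0\<^sub>v n")
  case True
  have "A *\<^sub>v v = 0\<^sub>v m" using A True by (intro eq_vecI) auto
  then show ?thesis using True by (simp add: vnorm_def)
next
  case False
  then have pos: "vnorm v > 0" using scalar_prod_self_pos[OF v] by (simp add: vnorm_eq_sqrt)
  define w where "w = (1 / vnorm v) \<cdot>\<^sub>v v"
  have w: "w \<in> carrier_vec n" "vnorm w = 1" using v pos by (auto simp: w_def vnorm_smult)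
  have "bdd_above {vnorm (A *\<^sub>v v) | v. v \<in> carrier_vec (dim_col A) \<and> vnorm v = 1}"
  proof (rule bdd_aboveI, clarify)
    fix v :: "real vec" assume "v \<in> carrier_vec (dim_col A)" "vnorm v = 1"
    then show "vnorm (A *\<^sub>v v) \<le> (\<Sum>i<m. \<Sum>j<n. \<bar>A $$ (i,j)\<bar>)"
      using vnorm_mult_le_sum_entries[OF A, of v] A by simp
  qed
  then have "vnorm (A *\<^sub>v w) \<le> spec_norm A"
    unfolding spec_norm_def by (rule cSup_upper[rotated]) (use w A in auto)
  moreover have "vnorm (A *\<^sub>v w) = vnorm (A *\<^sub>v v) / vnorm v"
    using A v pos by (simp add: w_def mult_mat_vec[of _ m n] vnorm_smult)
  ultimately show ?thesis using pos by (simp add: field_simps)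
qed

text \<open>With no columns there is no unit vector and \<open>Sup\<close> is taken over the empty
  set, hence n \<ge> 1.\<close>

lemma spec_norm_le:
  assumes A: "A \<in> carrier_mat m n" and n: "n \<ge> 1"
    and le: "\<And>v. v \<in> carrier_vec n \<Longrightarrow> vnorm v = 1 \<Longrightarrow> vnorm (A *\<^sub>v v) \<le> b"
  shows "spec_norm A \<le> b"
  unfolding spec_norm_def
proof (rule cSup_least)
  have "vnorm (unit_vec n 0) = 1" using n
    by (simp add: vnorm_eq_sqrt)
  then show "{vnorm (A *\<^sub>v v) | v. v \<in> carrier_vec (dim_col A) \<and> vnorm v = 1} \<noteq> {}"
    using A unit_vec_carrier[of n 0] by blast
qed (use A le in auto)

lemma spec_norm_diff_le_sum_entries:
  assumes A: "A \<in> carrier_mat m n" and B: "B \<in> carrier_mat m n" and n: "n \<ge> 1"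
  shows "\<bar>spec_norm A - spec_norm B\<bar> \<le> (\<Sum>i<m. \<Sum>j<n. \<bar>A $$ (i,j) - B $$ (i,j)\<bar>)"
proof -
  have *: "spec_norm A \<le> spec_norm B + (\<Sum>i<m. \<Sum>j<n. \<bar>A $$ (i,j) - B $$ (i,j)\<bar>)"
    if A: "A \<in> carrier_mat m n" and B: "B \<in> carrier_mat m n" for A B :: "real mat"
  proof (rule spec_norm_le[OF A n])
    fix v :: "real vec" assume v: "v \<in> carrier_vec n" "vnorm v = 1"
    have "A *\<^sub>v v = B *\<^sub>v v + (A - B) *\<^sub>v v"
      using A B v by (simp add: minus_mult_distrib_mat_vec) (intro eq_vecI, auto)
    also have "vnorm \<dots> \<le> vnorm (B *\<^sub>v v) + vnorm ((A - B) *\<^sub>v v)"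
      by (rule vnorm_triangle[of _ m]) (use A B v in \<open>auto intro!: mult_mat_vec_carrier minus_carrier_mat\<close>)
    also have "vnorm (B *\<^sub>v v) \<le> spec_norm B"
      using vnorm_mult_le_spec_norm[OF B v(1)] v by simp
    also have "vnorm ((A - B) *\<^sub>v v) \<le> (\<Sum>i<m. \<Sum>j<n. \<bar>(A - B) $$ (i,j)\<bar>) * vnorm v"
      by (rule vnorm_mult_le_sum_entries[OF _ v(1)]) (use A B in auto)
    also have "(\<Sum>i<m. \<Sum>j<n. \<bar>(A - B) $$ (i,j)\<bar>) = (\<Sum>i<m. \<Sum>j<n. \<bar>A $$ (i,j) - B $$ (i,j)\<bar>)"
      by (intro sum.cong refl) (use A B in auto)
    finally show "vnorm (A *\<^sub>v v) \<le> spec_norm B + (\<Sum>i<m. \<Sum>j<n. \<bar>A $$ (i,j) - B $$ (i,j)\<bar>)"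
      using v by simp
  qed
  show ?thesis
    using *[OF A B] *[OF B A] by (simp add: abs_le_iff abs_minus_commute)
qed

text \<open>A non-measurable set has \<open>prob\<close> equal to 0, so the in-probability hypotheses say
  something, and the conclusion can hold, only because spectral norms and eigenvalues are
  measurable functions of the entries.\<close>

lemma borel_measurable_lipschitz_entries:
  fixes \<phi> :: "('i :: countable \<Rightarrow> real) \<Rightarrow> real"
  assumes g: "\<And>p. g p \<in> borel_measurable M"
    and S: "finite S" and lip: "\<And>x y. \<bar>\<phi> x - \<phi> y\<bar> \<le> (\<Sum>p\<in>S. \<bar>x p - y p\<bar>)"
  shows "(\<lambda>\<omega>. \<phi> (\<lambda>p. g p \<omega>)) \<in> borel_measurable M"
proof -
  \<comment> \<open>Coordinates are continuous in the product topology, so the finite sum that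
    bounds the variation of \<phi> tends to 0 at each point.\<close>
  have "continuous_on UNIV \<phi>"
    unfolding continuous_on_def
  proof
    fix x :: "'i \<Rightarrow> real"
    have "((\<lambda>y :: 'i \<Rightarrow> real. y p) \<longlongrightarrow> x p) (at x within UNIV)" for p
      by (rule continuous_on_tendsto_compose[OF continuous_on_product_coordinates tendsto_ident_at]) auto
    then have "((\<lambda>y. \<Sum>p\<in>S. \<bar>y p - x p\<bar>) \<longlongrightarrow> (\<Sum>p\<in>S. \<bar>x p - x p\<bar>)) (at x within UNIV)"
      by (intro tendsto_sum tendsto_rabs tendsto_diff tendsto_const)
    then have lim: "((\<lambda>y. \<Sum>p\<in>S. \<bar>y p - x p\<bar>) \<longlongrightarrow> 0) (at x within UNIV)" by simp
    have "((\<lambda>y. \<phi> y - \<phi> x) \<longlongrightarrow> 0) (at x within UNIV)"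
      by (rule Lim_null_comparison[OF _ lim]) (use lip in \<open>simp add: always_eventually\<close>)
    then show "(\<phi> \<longlongrightarrow> \<phi> x) (at x within UNIV)" by (rule Lim_null[THEN iffD2])
  qed
  then have "\<phi> \<in> borel_measurable borel" by (rule borel_measurable_continuous_onI)
  \<comment> \<open>The index type is countable, so measurability of every coordinate gives
    measurability into the Borel sets of the product.\<close>
  moreover have "(\<lambda>\<omega> p. g p \<omega>) \<in> borel_measurable M"
    using g by (rule measurable_coordinatewise_then_product)
  ultimately show ?thesis by (rule measurable_compose[rotated])
qed

lemma borel_measurable_spec_norm:
  assumes g: "\<And>i j. g i j \<in> borel_measurable M" and n: "n \<ge> 1"
  shows "(\<lambda>\<omega>. spec_norm (mat m n (\<lambda>(i,j). g i j \<omega>))) \<in> borel_measurable M"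
proof -
  have "(\<lambda>\<omega>. spec_norm (mat m n (\<lambda>p. g (fst p) (snd p) \<omega>))) \<in> borel_measurable M"
  proof (rule borel_measurable_lipschitz_entries[where S = "{..<m} \<times> {..<n}"
        and \<phi> = "\<lambda>x. spec_norm (mat m n x)" and g = "\<lambda>p. g (fst p) (snd p)"])
    fix x y :: "nat \<times> nat \<Rightarrow> real"
    show "\<bar>spec_norm (mat m n x) - spec_norm (mat m n y)\<bar> \<le> (\<Sum>p\<in>{..<m} \<times> {..<n}. \<bar>x p - y p\<bar>)"
      using spec_norm_diff_le_sum_entries[of "mat m n x" m n "mat m n y"] n
      by (simp add: sum.cartesian_product case_prod_unfold)
  qed (use g in auto)
  then show ?thesis by (simp add: case_prod_unfold)
qed

lemma borel_measurable_eig: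
  assumes g: "\<And>i l. g i l \<in> borel_measurable M" and sym: "\<And>i l. g i l = g l i"
    and j: "1 \<le> j" "j \<le> n"
  shows "(\<lambda>\<omega>. eig j (mat n n (\<lambda>(i,l). g i l \<omega>))) \<in> borel_measurable M"
proof -
  \<comment> \<open>The Lipschitz bound must hold for all arrays, while eigenvalues are controlled
    only for symmetric matrices. Averaging with the transpose extends the map to all arrays and
    changes nothing on symmetric ones.\<close>
  define s where "s x = mat n n (\<lambda>(i,l). (x (i,l) + x (l,i)) / (2::real))" for x
  have "(\<lambda>\<omega>. eig j (s (\<lambda>p. g (fst p) (snd p) \<omega>))) \<in> borel_measurable M"
  proof (rule borel_measurable_lipschitz_entries[where S = "{..<n} \<times> {..<n}"
        and \<phi> = "\<lambda>x. eig j (s x)" and g = "\<lambda>p. g (fst p) (snd p)"])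
    fix x y :: "nat \<times> nat \<Rightarrow> real"
    have s: "s x \<in> carrier_mat n n" "transpose_mat (s x) = s x" for x
      by (auto simp: s_def intro!: eq_matI)
    have "\<bar>eig j (s x) - eig j (s y)\<bar> \<le> (\<Sum>i<n. \<Sum>l<n. \<bar>s x $$ (i,l) - s y $$ (i,l)\<bar>)"
      by (rule eig_diff_le_sum_entries[OF s s j])
    also have "\<dots> \<le> (\<Sum>i<n. \<Sum>l<n. \<bar>x (i,l) - y (i,l)\<bar> / 2 + \<bar>x (l,i) - y (l,i)\<bar> / 2)"
    proof (intro sum_mono)
      fix i l assume "i \<in> {..<n}" "l \<in> {..<n}"
      moreover have "\<bar>(a + b) / 2 - (c + d) / 2\<bar> \<le> \<bar>a - c\<bar> / 2 + \<bar>b - d\<bar> / 2" for a b c d :: real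
        by (simp add: abs_if field_simps)
      ultimately show "\<bar>s x $$ (i,l) - s y $$ (i,l)\<bar> \<le> \<bar>x (i,l) - y (i,l)\<bar> / 2 + \<bar>x (l,i) - y (l,i)\<bar> / 2"
        by (simp add: s_def)
    qed
    also have "\<dots> = (\<Sum>i<n. \<Sum>l<n. \<bar>x (i,l) - y (i,l)\<bar> / 2) + (\<Sum>l<n. \<Sum>i<n. \<bar>x (l,i) - y (l,i)\<bar> / 2)"
      unfolding sum.distrib by (subst (3) sum.swap) simp
    also have "\<dots> = (\<Sum>p\<in>{..<n} \<times> {..<n}. \<bar>x p - y p\<bar>)"
      by (simp add: sum.cartesian_product case_prod_unfold sum_divide_distrib[symmetric])
    finally show "\<bar>eig j (s x) - eig j (s y)\<bar> \<le> (\<Sum>p\<in>{..<n} \<times> {..<n}. \<bar>x p - y p\<bar>)" .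
  qed (use g in auto)
  moreover have "s (\<lambda>p. g (fst p) (snd p) \<omega>) = mat n n (\<lambda>(i,l). g i l \<omega>)" for \<omega>
    using sym by (intro eq_matI) (auto simp: s_def)
  ultimately show ?thesis by simp
qed

section \<open>Quadratic forms, Gram matrices and two-sided norm bounds\<close>

lemma scalar_prod_le_vnorm:
  assumes "u \<in> carrier_vec n" "v \<in> carrier_vec n"
  shows "\<bar>u \<bullet> v\<bar> \<le> vnorm u * vnorm v"
proof -
  have "\<bar>u \<bullet> v\<bar> \<le> (\<Sum>i<n. \<bar>u $ i\<bar> * \<bar>v $ i\<bar>)"
    using assms sum_abs[of "\<lambda>i. u $ i * v $ i" "{..<n}"]
    by (simp add: scalar_prod_def lessThan_atLeast0 abs_mult)
  also have "\<dots> \<le> L2_set (\<lambda>i. u $ i) {..<n} * L2_set (\<lambda>i. v $ i) {..<n}"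
    by (rule L2_set_mult_ineq)
  finally show ?thesis using assms by (simp add: L2_set_def vnorm_def)
qed

lemma abs_quadratic_form_le_spec_norm:
  assumes "D \<in> carrier_mat n n" "v \<in> carrier_vec n"
  shows "\<bar>v \<bullet> (D *\<^sub>v v)\<bar> \<le> spec_norm D * (vnorm v)\<^sup>2"
proof -
  have "\<bar>v \<bullet> (D *\<^sub>v v)\<bar> \<le> vnorm v * vnorm (D *\<^sub>v v)"
    by (rule scalar_prod_le_vnorm) (use assms in auto)
  also have "\<dots> \<le> vnorm v * (spec_norm D * vnorm v)"
    by (intro mult_left_mono vnorm_mult_le_spec_norm[OF assms]) simp
  finally show ?thesis by (simp add: power2_eq_square mult_ac)
qed

lemma
  fixes X :: "real mat"
  assumes X: "X \<in> carrier_mat m n"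
  shows gram_carrier: "c \<cdot>\<^sub>m (transpose_mat X * X) \<in> carrier_mat n n"
    and gram_symmetric: "transpose_mat (c \<cdot>\<^sub>m (transpose_mat X * X)) = c \<cdot>\<^sub>m (transpose_mat X * X)"
proof -
  show "c \<cdot>\<^sub>m (transpose_mat X * X) \<in> carrier_mat n n" using X by simp
  show "transpose_mat (c \<cdot>\<^sub>m (transpose_mat X * X)) = c \<cdot>\<^sub>m (transpose_mat X * X)"
    using X by (intro eq_matI) (auto simp: comm_scalar_prod[of _ m])
qed

lemma smult_mat_mult_vec:
  fixes A :: "real mat"
  assumes "A \<in> carrier_mat m n" "v \<in> carrier_vec n"
  shows "(c \<cdot>\<^sub>m A) *\<^sub>v v = c \<cdot>\<^sub>v (A *\<^sub>v v)"
  using assms by (intro eq_vecI) (auto simp: mult_mat_vec_index_sum[of _ m n] sum_distrib_left mult.assoc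
      simp del: index_mult_mat_vec)

lemma gram_quadratic_form:
  assumes X: "X \<in> carrier_mat m n" and v: "v \<in> carrier_vec n"
  shows "v \<bullet> ((c \<cdot>\<^sub>m (transpose_mat X * X)) *\<^sub>v v) = c * (vnorm (X *\<^sub>v v))\<^sup>2"
proof -
  have Xv: "X *\<^sub>v v \<in> carrier_vec m" using X v by simp
  have "(c \<cdot>\<^sub>m (transpose_mat X * X)) *\<^sub>v v = c \<cdot>\<^sub>v ((transpose_mat X * X) *\<^sub>v v)"
    by (rule smult_mat_mult_vec[OF _ v, of _ n]) (use X in auto)
  also have "(transpose_mat X * X) *\<^sub>v v = transpose_mat X *\<^sub>v (X *\<^sub>v v)"
    using X v by simp
  finally have "v \<bullet> ((c \<cdot>\<^sub>m (transpose_mat X * X)) *\<^sub>v v) = c * (v \<bullet> (transpose_mat X *\<^sub>v (X *\<^sub>v v)))"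
    using X v by simp
  also have "v \<bullet> (transpose_mat X *\<^sub>v (X *\<^sub>v v)) = (X *\<^sub>v v) \<bullet> (X *\<^sub>v v)"
    using scalar_prod_mult_mat_vec[of "transpose_mat X" n m v "X *\<^sub>v v"] X v by simp
  finally show ?thesis by (simp add: vnorm_power2)
qed

lemma sym_pos_def_eig:
  assumes S: "sym_pos_def S r" and r: "r \<ge> 1"
  shows "eig r S > 0"
    and "\<And>v. v \<in> carrier_vec r \<Longrightarrow> eig r S * (vnorm v)\<^sup>2 \<le> v \<bullet> (S *\<^sub>v v)"
    and "\<And>v. v \<in> carrier_vec r \<Longrightarrow> v \<bullet> (S *\<^sub>v v) \<le> eig 1 S * (vnorm v)\<^sup>2"
proof -
  have Sc: "S \<in> carrier_mat r r" "transpose_mat S = S"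
    and pos: "\<And>v. v \<in> carrier_vec r \<Longrightarrow> v \<noteq> 0\<^sub>v r \<Longrightarrow> v \<bullet> (S *\<^sub>v v) > 0"
    using S by (auto simp: sym_pos_def_def)
  obtain es where es: "char_poly S = (\<Prod>e\<leftarrow>es. [:- e, 1:])" "length es = r"
    "\<And>j. eig j S = es ! (j - 1)"
    using symmetric_eig_list[OF Sc] by metis
  obtain q where q: "\<And>i. i < r \<Longrightarrow> q i \<in> carrier_vec r"
    "\<And>i. i < r \<Longrightarrow> S *\<^sub>v q i = es ! i \<cdot>\<^sub>v q i"
    "\<And>i j. i < r \<Longrightarrow> j < r \<Longrightarrow> q i \<bullet> q j = (if i = j then 1 else 0)"
    using symmetric_eigenbasis[OF Sc es(1,2)] by metis
  \<comment> \<open>The last eigenvector sits at position r - 1, and the form takes the value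
    \<open>eig r S\<close> there, so definiteness yields positivity at once.\<close>
  have r1: "r - 1 < r" using r by simp
  have "q (r - 1) \<noteq> 0\<^sub>v r" using q(3)[OF r1 r1] by auto
  then have "0 < q (r - 1) \<bullet> (S *\<^sub>v q (r - 1))" using pos q(1)[OF r1] by blast
  also have "\<dots> = eig r S" using q(1,2)[OF r1] q(3)[OF r1 r1] es(3) by simp
  finally show "eig r S > 0" .
  obtain Q where Q: "\<forall>v \<in> carrier_vec r. v \<bullet> v = (\<Sum>i<r. ((transpose_mat Q *\<^sub>v v) $ i)\<^sup>2) \<and>
      v \<bullet> (S *\<^sub>v v) = (\<Sum>i<r. eig (Suc i) S * ((transpose_mat Q *\<^sub>v v) $ i)\<^sup>2)"
    using symmetric_spectral[OF Sc] by blast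
  show "eig r S * (vnorm v)\<^sup>2 \<le> v \<bullet> (S *\<^sub>v v)" if "v \<in> carrier_vec r" for v
    using Q that eig_antimono[OF Sc] r
    by (auto simp: vnorm_power2 sum_distrib_left intro!: sum_mono mult_right_mono)
  show "v \<bullet> (S *\<^sub>v v) \<le> eig 1 S * (vnorm v)\<^sup>2" if "v \<in> carrier_vec r" for v
    using Q that eig_antimono[OF Sc] r
    by (auto simp: vnorm_power2 sum_distrib_left intro!: sum_mono mult_right_mono)
qed

text \<open>The deviation from \<open>S\<close> costs at most half of the smallest eigenvalue, so
  the other half survives from below; from above, \<open>eig 1 S + eig r S / 2\<close> is absorbed
  into \<open>2 * eig 1 S\<close>.\<close>

lemma gram_near_pos_def_bounds:
  assumes F: "F \<in> carrier_mat T r" and T: "T \<ge> 1" and r: "r \<ge> 1" and S: "sym_pos_def S r"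
    and near: "spec_norm ((1 / real T) \<cdot>\<^sub>m (transpose_mat F * F) - S) \<le> eig r S / 2"
    and u: "u \<in> carrier_vec r"
  shows "eig r S / 2 * real T * (vnorm u)\<^sup>2 \<le> (vnorm (F *\<^sub>v u))\<^sup>2"
    and "(vnorm (F *\<^sub>v u))\<^sup>2 \<le> (2 * eig 1 S) * real T * (vnorm u)\<^sup>2"
proof -
  define G where "G = (1 / real T) \<cdot>\<^sub>m (transpose_mat F * F)"
  have Sc: "S \<in> carrier_mat r r" "transpose_mat S = S" using S by (auto simp: sym_pos_def_def)
  have Gc: "G \<in> carrier_mat r r" unfolding G_def by (rule gram_carrier[OF F])
  have eq: "(G - S) *\<^sub>v u = G *\<^sub>v u - S *\<^sub>v u"
    using Gc Sc u by (simp add: minus_mult_distrib_mat_vec)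
  have "u \<bullet> ((G - S) *\<^sub>v u) = u \<bullet> (G *\<^sub>v u) - u \<bullet> (S *\<^sub>v u)"
    unfolding eq by (rule scalar_prod_minus_distrib[of _ r]) (use Gc Sc u in auto)
  moreover have "u \<bullet> (G *\<^sub>v u) = (vnorm (F *\<^sub>v u))\<^sup>2 / real T"
    unfolding G_def gram_quadratic_form[OF F u] by simp
  moreover have "\<bar>u \<bullet> ((G - S) *\<^sub>v u)\<bar> \<le> spec_norm (G - S) * (vnorm u)\<^sup>2"
    by (rule abs_quadratic_form_le_spec_norm[OF _ u]) (use Gc Sc in auto)
  moreover have "spec_norm (G - S) * (vnorm u)\<^sup>2 \<le> eig r S / 2 * (vnorm u)\<^sup>2"
    using near by (intro mult_right_mono) (auto simp: G_def)
  moreover have "eig r S * (vnorm u)\<^sup>2 \<le> u \<bullet> (S *\<^sub>v u)" "u \<bullet> (S *\<^sub>v u) \<le> eig 1 S * (vnorm u)\<^sup>2"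
    using sym_pos_def_eig(2,3)[OF S r u] .
  moreover have "eig r S * (vnorm u)\<^sup>2 \<le> eig 1 S * (vnorm u)\<^sup>2"
    by (intro mult_right_mono eig_antimono[OF Sc]) (use r in auto)
  moreover have "eig r S / 2 * (vnorm u)\<^sup>2 = eig r S * (vnorm u)\<^sup>2 / 2" by simp
  moreover have "eig r S * (vnorm u)\<^sup>2 \<ge> 0" using sym_pos_def_eig(1)[OF S r] by simp
  ultimately have "eig r S / 2 * (vnorm u)\<^sup>2 \<le> (vnorm (F *\<^sub>v u))\<^sup>2 / real T"
    "(vnorm (F *\<^sub>v u))\<^sup>2 / real T \<le> 2 * (eig 1 S * (vnorm u)\<^sup>2)"
    unfolding abs_le_iff by linarith+
  then show "eig r S / 2 * real T * (vnorm u)\<^sup>2 \<le> (vnorm (F *\<^sub>v u))\<^sup>2"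
    "(vnorm (F *\<^sub>v u))\<^sup>2 \<le> (2 * eig 1 S) * real T * (vnorm u)\<^sup>2"
    using T by (auto simp: field_simps)
qed

text \<open>The vector w with entries \<open>sqrt (d j) * u $ j\<close> undoes the scaling: ||L
  u||^2 is the form at w of a matrix within 1/2 of the identity, so it lies between half and twice
  ||w||^2, the sum of the squares of u weighted by \<open>d\<close>. The entries of \<open>d\<close>
  may have different orders of magnitude; only their range matters.\<close>

lemma scaled_gram_near_identity_bounds:
  assumes L: "L \<in> carrier_mat N r" 
    and d: "\<And>j. j < r \<Longrightarrow> lo \<le> d j \<and> d j \<le> hi" and lo: "lo > 0"
    and near: "spec_norm (Defs.diag_mat r (\<lambda>j. 1 / sqrt (d j)) * (transpose_mat L * L)
      * Defs.diag_mat r (\<lambda>j. 1 / sqrt (d j)) - 1\<^sub>m r) \<le> 1 / 2"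
    and u: "u \<in> carrier_vec r"
  shows "lo / 2 * (vnorm u)\<^sup>2 \<le> (vnorm (L *\<^sub>v u))\<^sup>2"
    and "(vnorm (L *\<^sub>v u))\<^sup>2 \<le> 2 * hi * (vnorm u)\<^sup>2"
proof -
  define D where "D = Defs.diag_mat r (\<lambda>j. 1 / sqrt (d j))"
  have D: "D \<in> carrier_mat r r" "transpose_mat D = D"
    by (auto simp: D_def Defs.diag_mat_def)
  have dpos: "d j > 0" if "j < r" for j using d[OF that] lo by linarith
  define w where "w = vec r (\<lambda>j. sqrt (d j) * u $ j)"
  have w: "w \<in> carrier_vec r" by (simp add: w_def)
  have Dw: "D *\<^sub>v w = u"
  proof (intro eq_vecI)
    fix i assume "i < dim_vec u"
    then have i: "i < r" using u by simp
    have "(D *\<^sub>v w) $ i = (\<Sum>j<r. D $$ (i,j) * w $ j)" by (rule mult_mat_vec_index_sum[OF D(1) w i])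
    also have "\<dots> = (\<Sum>j<r. if j = i then u $ j else 0)"
      using i dpos[OF i] by (intro sum.cong refl) (auto simp: D_def Defs.diag_mat_def w_def)
    finally show "(D *\<^sub>v w) $ i = u $ i" using i by simp
  qed (use D u in auto)
  define G where "G = D * (transpose_mat L * L) * D"
  have LL: "transpose_mat L * L \<in> carrier_mat r r" using L by simp
  have G: "G \<in> carrier_mat r r"
    unfolding G_def by (rule mult_carrier_mat[OF mult_carrier_mat[OF D(1) LL] D(1)])
  have "G *\<^sub>v w = (D * (transpose_mat L * L)) *\<^sub>v u"
    unfolding G_def using D LL w Dw by (subst assoc_mult_mat_vec[of _ r r _ r]) auto
  also have "\<dots> = D *\<^sub>v ((transpose_mat L * L) *\<^sub>v u)"
    by (rule assoc_mult_mat_vec[OF D(1) LL u])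
  finally have "w \<bullet> (G *\<^sub>v w) = w \<bullet> (D *\<^sub>v ((transpose_mat L * L) *\<^sub>v u))" by simp
  also have "\<dots> = u \<bullet> ((transpose_mat L * L) *\<^sub>v u)"
    using scalar_prod_mult_mat_vec[OF D(1) w, of "(transpose_mat L * L) *\<^sub>v u"] LL u D(2) Dw by simp
  also have "(transpose_mat L * L) *\<^sub>v u = (1 \<cdot>\<^sub>m (transpose_mat L * L)) *\<^sub>v u"
    using smult_mat_mult_vec[OF LL u, of 1] LL u by simp
  also have "u \<bullet> \<dots> = (vnorm (L *\<^sub>v u))\<^sup>2" unfolding gram_quadratic_form[OF L u] by simp
  finally have wG: "w \<bullet> (G *\<^sub>v w) = (vnorm (L *\<^sub>v u))\<^sup>2" .
  have eq: "(G - 1\<^sub>m r) *\<^sub>v w = G *\<^sub>v w - w"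
    using G w by (simp add: minus_mult_distrib_mat_vec)
  have "w \<bullet> ((G - 1\<^sub>m r) *\<^sub>v w) = w \<bullet> (G *\<^sub>v w) - w \<bullet> w"
    unfolding eq by (rule scalar_prod_minus_distrib[of _ r]) (use G w in auto)
  moreover have "\<bar>w \<bullet> ((G - 1\<^sub>m r) *\<^sub>v w)\<bar> \<le> spec_norm (G - 1\<^sub>m r) * (vnorm w)\<^sup>2"
    by (rule abs_quadratic_form_le_spec_norm[OF _ w]) (use G in auto)
  moreover have "spec_norm (G - 1\<^sub>m r) * (vnorm w)\<^sup>2 \<le> 1 / 2 * (vnorm w)\<^sup>2"
    using near by (intro mult_right_mono) (auto simp: G_def D_def)
  moreover have "(vnorm w)\<^sup>2 \<ge> 0" by simp
  ultimately have *: "(vnorm w)\<^sup>2 / 2 \<le> (vnorm (L *\<^sub>v u))\<^sup>2" "(vnorm (L *\<^sub>v u))\<^sup>2 \<le> 2 * (vnorm w)\<^sup>2"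
    unfolding abs_le_iff wG vnorm_power2 by linarith+
  have ww: "(vnorm w)\<^sup>2 = (\<Sum>j<r. d j * (u $ j)\<^sup>2)"
    unfolding vnorm_power2 scalar_prod_self_sum
    using dpos by (intro sum.cong) (auto simp: w_def power_mult_distrib less_imp_le)
  have uu: "(vnorm u)\<^sup>2 = (\<Sum>j<r. (u $ j)\<^sup>2)"
    unfolding vnorm_power2 scalar_prod_self_sum using u by simp
  have "lo * (vnorm u)\<^sup>2 \<le> (vnorm w)\<^sup>2" "(vnorm w)\<^sup>2 \<le> hi * (vnorm u)\<^sup>2"
    unfolding ww uu sum_distrib_left using d by (auto intro!: sum_mono mult_right_mono)
  then show "lo / 2 * (vnorm u)\<^sup>2 \<le> (vnorm (L *\<^sub>v u))\<^sup>2" "(vnorm (L *\<^sub>v u))\<^sup>2 \<le> 2 * hi * (vnorm u)\<^sup>2"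
    using * by auto
qed

text \<open>The ratio at r is at least a / b, the earlier ones are at most e / a and the later ones
  at most b / g; \<open>eb\<close> and \<open>bb\<close> are these comparisons cleared of
  denominators. The bound \<open>g\<close> at position m + 1 also makes every denominator
  positive.\<close>

lemma consecutive_ratio_max:
  fixes l :: "nat \<Rightarrow> real"
  assumes anti: "\<And>i j. 1 \<le> i \<Longrightarrow> i \<le> j \<Longrightarrow> j \<le> m + 1 \<Longrightarrow> l j \<le> l i"
    and r: "1 \<le> r" "r < m"
    and bounds: "a \<le> l r" "l (r + 1) \<le> b" "l 1 \<le> e" "g \<le> l (m + 1)"
    and pos: "0 < a" "0 < g" and eb: "e * b < a * a" and bb: "b * b < a * g"
  shows "\<forall>k \<in> {1..m}. k \<noteq> r \<longrightarrow> l k / l (k + 1) < l r / l (r + 1)"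
proof (intro ballI impI)
  fix k assume k: "k \<in> {1..m}" "k \<noteq> r"
  have lpos: "l i > 0" if "1 \<le> i" "i \<le> m + 1" for i
    using anti[of i "m + 1"] that bounds(4) pos(2) by auto
  have b: "b > 0" using bounds(2) lpos[of "r + 1"] r by auto
  have ab: "a / b \<le> l r / l (r + 1)"
    by (rule frac_le) (use bounds lpos[of r] lpos[of "r + 1"] r b in auto)
  show "l k / l (k + 1) < l r / l (r + 1)"
  proof (cases "k < r")
    case True
    have "l k / l (k + 1) \<le> e / a"
      by (rule frac_le) (use anti[of 1 k] anti[of "k + 1" r] lpos[of 1] bounds pos k r True in auto)
    also have "\<dots> < a / b" using eb pos b by (simp add: field_simps)
    finally show ?thesis using ab by linarith
  next
    case False
    have "l k / l (k + 1) \<le> b / g"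
      by (rule frac_le) (use anti[of "r + 1" k] anti[of "k + 1" "m + 1"] bounds pos b k False in auto)
    also have "\<dots> < a / b" using bb pos b by (simp add: field_simps)
    finally show ?thesis using ab by linarith
  qed
qed

section \<open>Eigenvalues of an approximate factor model\<close>

lemma vnorm_triangle_rev:
  assumes "u \<in> carrier_vec n" "v \<in> carrier_vec n"
  shows "vnorm u \<le> vnorm (u + v) + vnorm v"
proof -
  have "u = (u + v) + (- 1) \<cdot>\<^sub>v v" using assms by (intro eq_vecI) auto
  then have "vnorm u \<le> vnorm (u + v) + vnorm ((- 1) \<cdot>\<^sub>v v)"
    using vnorm_triangle[of "u + v" n "(- 1) \<cdot>\<^sub>v v"] assms by simp
  then show ?thesis by (simp add: vnorm_smult)
qed

text \<open>A matrix and its transpose have the same operator norm. For u the image of v under the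
  transpose, ||u||^2 is the scalar product of v and L u, hence at most ||v|| ||L u||; after
  squaring, one factor ||u||^2 cancels.\<close>

lemma vnorm_transpose_mult_le:
  assumes L: "L \<in> carrier_mat N r" and m: "m \<ge> 0" and v: "v \<in> carrier_vec N"
    and le: "\<And>u. u \<in> carrier_vec r \<Longrightarrow> (vnorm (L *\<^sub>v u))\<^sup>2 \<le> m * (vnorm u)\<^sup>2"
  shows "(vnorm (transpose_mat L *\<^sub>v v))\<^sup>2 \<le> m * (vnorm v)\<^sup>2"
proof -
  define u where "u = transpose_mat L *\<^sub>v v"
  have u: "u \<in> carrier_vec r" using L v by (simp add: u_def)
  have Lu: "L *\<^sub>v u \<in> carrier_vec N" using L u by simp
  have "(vnorm u)\<^sup>2 = v \<bullet> (L *\<^sub>v u)"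
    unfolding vnorm_power2 scalar_prod_mult_mat_vec[OF L v u] by (simp add: u_def)
  also have "\<dots> \<le> vnorm v * vnorm (L *\<^sub>v u)"
    using scalar_prod_le_vnorm[OF v Lu] by simp
  finally have "((vnorm u)\<^sup>2)\<^sup>2 \<le> (vnorm v * vnorm (L *\<^sub>v u))\<^sup>2"
    by (rule power_mono) simp
  also have "\<dots> \<le> (vnorm v)\<^sup>2 * (m * (vnorm u)\<^sup>2)"
    unfolding power_mult_distrib by (intro mult_left_mono le u) simp
  finally have *: "(vnorm u)\<^sup>2 * (vnorm u)\<^sup>2 \<le> m * (vnorm v)\<^sup>2 * (vnorm u)\<^sup>2"
    by (simp add: power2_eq_square mult_ac)
  show ?thesis
  proof (cases "vnorm u = 0")
    case True
    then show ?thesis using m by (simp add: u_def)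
  next
    case False
    then have "(vnorm u)\<^sup>2 > 0" by simp
    then show ?thesis using * mult_le_cancel_right_pos unfolding u_def by blast
  qed
qed

text \<open>For v = L u, ||v||^2 is the scalar product of u with the transpose applied to v, and
  ||u|| is at most ||v|| / sqrt m. The restriction to the range of \<open>L\<close> is essential,
  since the transpose may have a kernel.\<close>

lemma vnorm_transpose_mult_ge:
  assumes L: "L \<in> carrier_mat N r" and m: "m > 0" and u: "u \<in> carrier_vec r"
    and ge: "m * (vnorm u)\<^sup>2 \<le> (vnorm (L *\<^sub>v u))\<^sup>2"
  shows "m * (vnorm (L *\<^sub>v u))\<^sup>2 \<le> (vnorm (transpose_mat L *\<^sub>v (L *\<^sub>v u)))\<^sup>2"
proof -
  define v where "v = L *\<^sub>v u"
  have v: "v \<in> carrier_vec N" using L u by (simp add: v_def)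
  have Lv: "transpose_mat L *\<^sub>v v \<in> carrier_vec r" using L v by simp
  have "(vnorm v)\<^sup>2 = (transpose_mat L *\<^sub>v v) \<bullet> u"
    unfolding vnorm_power2 using scalar_prod_mult_mat_vec[OF L v u] by (simp add: v_def)
  also have "\<dots> \<le> vnorm (transpose_mat L *\<^sub>v v) * vnorm u"
    using scalar_prod_le_vnorm[OF Lv u] by simp
  finally have "((vnorm v)\<^sup>2)\<^sup>2 \<le> (vnorm (transpose_mat L *\<^sub>v v) * vnorm u)\<^sup>2"
    by (rule power_mono) simp
  then have "m * ((vnorm v)\<^sup>2)\<^sup>2 \<le> m * ((vnorm (transpose_mat L *\<^sub>v v))\<^sup>2 * (vnorm u)\<^sup>2)"
    using m by (simp add: power_mult_distrib)
  also have "\<dots> = (vnorm (transpose_mat L *\<^sub>v v))\<^sup>2 * (m * (vnorm u)\<^sup>2)" by simp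
  also have "\<dots> \<le> (vnorm (transpose_mat L *\<^sub>v v))\<^sup>2 * (vnorm v)\<^sup>2"
    by (intro mult_left_mono) (use ge in \<open>auto simp: v_def\<close>)
  finally have *: "m * (vnorm v)\<^sup>2 * (vnorm v)\<^sup>2 \<le> (vnorm (transpose_mat L *\<^sub>v v))\<^sup>2 * (vnorm v)\<^sup>2"
    by (simp add: power2_eq_square mult_ac)
  show ?thesis
  proof (cases "vnorm v = 0")
    case True
    then show ?thesis by (simp add: v_def)
  next
    case False
    then have "(vnorm v)\<^sup>2 > 0" by simp
    then show ?thesis using * mult_le_cancel_right_pos unfolding v_def by blast
  qed
qed

lemma vnorm_mult_power2_le:
  assumes E: "E \<in> carrier_mat m n" and v: "v \<in> carrier_vec n" and le: "(spec_norm E)\<^sup>2 \<le> b"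
  shows "(vnorm (E *\<^sub>v v))\<^sup>2 \<le> b * (vnorm v)\<^sup>2"
proof -
  have "(vnorm (E *\<^sub>v v))\<^sup>2 \<le> (spec_norm E * vnorm v)\<^sup>2"
    by (intro power_mono vnorm_mult_le_spec_norm[OF E v]) simp
  also have "\<dots> \<le> b * (vnorm v)\<^sup>2"
    unfolding power_mult_distrib by (intro mult_right_mono le) simp
  finally show ?thesis .
qed

text \<open>The scale \<open>a\<close> is free because the noise Gram matrix will be normalized by
  the larger dimension while \<open>S\<close> is normalized by T; the factor a / T translates
  between the two.\<close>

lemma factor_model_eigenvalue_bounds:
  fixes F L E :: "real mat" and T :: nat
  defines "X \<equiv> F * transpose_mat L + E"
  defines "S \<equiv> (1 / real T) \<cdot>\<^sub>m (transpose_mat X * X)"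
  assumes F: "F \<in> carrier_mat T r" and L: "L \<in> carrier_mat N r" and E: "E \<in> carrier_mat T N"
    and T: "T \<ge> 1" and r: "r \<ge> 1" "r < N"
    and Flo: "\<And>u. u \<in> carrier_vec r \<Longrightarrow> \<kappa> * real T * (vnorm u)\<^sup>2 \<le> (vnorm (F *\<^sub>v u))\<^sup>2"
    and Fhi: "\<And>u. u \<in> carrier_vec r \<Longrightarrow> (vnorm (F *\<^sub>v u))\<^sup>2 \<le> K * real T * (vnorm u)\<^sup>2"
    and Llo: "\<And>u. u \<in> carrier_vec r \<Longrightarrow> m1 * (vnorm u)\<^sup>2 \<le> (vnorm (L *\<^sub>v u))\<^sup>2"
    and Lhi: "\<And>u. u \<in> carrier_vec r \<Longrightarrow> (vnorm (L *\<^sub>v u))\<^sup>2 \<le> m2 * (vnorm u)\<^sup>2"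
    and pos: "\<kappa> > 0" "K \<ge> 0" "m1 > 0" "m2 \<ge> 0"
    and Eb: "(spec_norm E)\<^sup>2 \<le> b * real T"
    and small: "4 * b \<le> \<kappa> * m1"
  shows "eig 1 S \<le> 2 * (K * m2 + b)" (is ?first)
    and "\<kappa> * m1 / 4 \<le> eig r S" (is ?rth)
    and "eig (r + 1) S \<le> b" (is ?next)
    and "\<And>j a. 1 \<le> j \<Longrightarrow> j + r \<le> N \<Longrightarrow> a > 0 \<Longrightarrow>
      eig (j + r) ((1 / a) \<cdot>\<^sub>m (transpose_mat E * E)) * (a / real T) \<le> eig j S"
proof -
  have X: "X \<in> carrier_mat T N" using F L E by (simp add: X_def)
  have Sc: "S \<in> carrier_mat N N" "transpose_mat S = S"
    unfolding S_def by (rule gram_carrier[OF X], rule gram_symmetric[OF X])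
  have form: "v \<bullet> (S *\<^sub>v v) = (vnorm (X *\<^sub>v v))\<^sup>2 / real T" if "v \<in> carrier_vec N" for v
    unfolding S_def gram_quadratic_form[OF X that] by simp
  have FL: "F *\<^sub>v (transpose_mat L *\<^sub>v v) \<in> carrier_vec T" and Ev: "E *\<^sub>v v \<in> carrier_vec T"
    if "v \<in> carrier_vec N" for v
    using F L E that by auto
  have Xv: "X *\<^sub>v v = F *\<^sub>v (transpose_mat L *\<^sub>v v) + E *\<^sub>v v" if v: "v \<in> carrier_vec N" for v
    unfolding X_def using F L E v
    by (subst add_mult_distrib_mat_vec[of _ T N]) (auto simp: assoc_mult_mat_vec[of F T r _ N])
  have XE: "X *\<^sub>v v = E *\<^sub>v v" if v: "v \<in> carrier_vec N" and 0: "transpose_mat L *\<^sub>v v = 0\<^sub>v r" for v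
  proof -
    have "F *\<^sub>v 0\<^sub>v r = 0\<^sub>v T" using F by (intro eq_vecI) auto
    then show ?thesis using Xv[OF v] 0 Ev[OF v] by simp
  qed
  have Evb: "(vnorm (E *\<^sub>v v))\<^sup>2 \<le> b * real T * (vnorm v)\<^sup>2" if "v \<in> carrier_vec N" for v
    by (rule vnorm_mult_power2_le[OF E that Eb])
  show ?next
  proof (rule eig_le_if_constraints[OF Sc])
    show "transpose_mat L \<in> carrier_mat r N" using L by simp
    fix v assume v: "v \<in> carrier_vec N" "transpose_mat L *\<^sub>v v = 0\<^sub>v r"
    show "v \<bullet> (S *\<^sub>v v) \<le> b * (v \<bullet> v)"
      unfolding form[OF v(1)] XE[OF v] using Evb[OF v(1)] T
      by (simp add: field_simps vnorm_power2)
  qed (use r in auto)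
  show ?first
  \<comment> \<open>The top eigenvalue tests every vector, hence the constraint matrix with 0
    rows.\<close>
  proof (rule eig_le_if_constraints[OF Sc zero_carrier_mat[of 0 N]])
    fix v :: "real vec" assume v: "v \<in> carrier_vec N"
    have Lv: "transpose_mat L *\<^sub>v v \<in> carrier_vec r" using L v by simp
    have "vnorm (X *\<^sub>v v) \<le> vnorm (F *\<^sub>v (transpose_mat L *\<^sub>v v)) + vnorm (E *\<^sub>v v)"
      unfolding Xv[OF v] by (rule vnorm_triangle[OF FL[OF v] Ev[OF v]])
    then have "(vnorm (X *\<^sub>v v))\<^sup>2 \<le> (vnorm (F *\<^sub>v (transpose_mat L *\<^sub>v v)) + vnorm (E *\<^sub>v v))\<^sup>2"
      by (rule power_mono) simp
    also have "\<dots> \<le> 2 * (vnorm (F *\<^sub>v (transpose_mat L *\<^sub>v v)))\<^sup>2 + 2 * (vnorm (E *\<^sub>v v))\<^sup>2"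
      using sum_squares_bound[of "vnorm (F *\<^sub>v (transpose_mat L *\<^sub>v v))" "vnorm (E *\<^sub>v v)"]
      by (simp add: power2_sum)
    also have "\<dots> \<le> 2 * (K * real T * (m2 * (vnorm v)\<^sup>2)) + 2 * (b * real T * (vnorm v)\<^sup>2)"
    proof -
      have "(vnorm (F *\<^sub>v (transpose_mat L *\<^sub>v v)))\<^sup>2 \<le> K * real T * (vnorm (transpose_mat L *\<^sub>v v))\<^sup>2"
        by (rule Fhi[OF Lv])
      also have "\<dots> \<le> K * real T * (m2 * (vnorm v)\<^sup>2)"
        by (intro mult_left_mono vnorm_transpose_mult_le[OF L pos(4) v Lhi]) (use pos in auto)
      finally show ?thesis using Evb[OF v] by simp
    qed
    also have "\<dots> = 2 * (K * m2 + b) * (v \<bullet> v) * real T"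
      by (simp add: vnorm_power2 algebra_simps)
    finally show "v \<bullet> (S *\<^sub>v v) \<le> 2 * (K * m2 + b) * (v \<bullet> v)"
      unfolding form[OF v] using T by (simp add: divide_le_eq)
  qed (use r in auto)
  show ?rth
  proof (rule eig_ge_if_subspace[OF Sc L zero_carrier_mat[of 0 N]])
    fix u :: "real vec" assume u: "u \<in> carrier_vec r"
    define v where "v = L *\<^sub>v u"
    have v: "v \<in> carrier_vec N" using L u by (simp add: v_def)
    have Lv: "transpose_mat L *\<^sub>v v \<in> carrier_vec r" using L v by simp
    define p where "p = vnorm (F *\<^sub>v (transpose_mat L *\<^sub>v v))"
    have "\<kappa> * real T * (m1 * (vnorm v)\<^sup>2) \<le> \<kappa> * real T * (vnorm (transpose_mat L *\<^sub>v v))\<^sup>2"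
      unfolding v_def
      by (intro mult_left_mono vnorm_transpose_mult_ge[OF L pos(3) u Llo[OF u]]) (use pos in auto)
    also have "\<dots> \<le> p\<^sup>2" unfolding p_def by (rule Flo[OF Lv])
    finally have p: "\<kappa> * m1 * real T * (vnorm v)\<^sup>2 \<le> p\<^sup>2" by (simp add: mult_ac)
    \<comment> \<open>The hypothesis \<open>small\<close> makes the noise at most half of the signal
      p in norm, so X v retains at least p / 2; squaring yields the factor 1/4.\<close>
    have "4 * (vnorm (E *\<^sub>v v))\<^sup>2 \<le> 4 * b * (real T * (vnorm v)\<^sup>2)"
      using Evb[OF v] by (simp add: mult_ac)
    also have "\<dots> \<le> \<kappa> * m1 * (real T * (vnorm v)\<^sup>2)"
      by (rule mult_right_mono[OF small]) simp
    also have "\<dots> \<le> p\<^sup>2" using p by (simp add: mult_ac)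
    finally have "(2 * vnorm (E *\<^sub>v v))\<^sup>2 \<le> p\<^sup>2" by (simp add: power_mult_distrib)
    then have "2 * vnorm (E *\<^sub>v v) \<le> p"
      by (rule power2_le_imp_le) (simp add: p_def)
    moreover have "p \<le> vnorm (X *\<^sub>v v) + vnorm (E *\<^sub>v v)"
      unfolding p_def Xv[OF v] by (rule vnorm_triangle_rev[OF FL[OF v] Ev[OF v]])
    ultimately have "p \<le> 2 * vnorm (X *\<^sub>v v)" by linarith
    then have "p\<^sup>2 \<le> (2 * vnorm (X *\<^sub>v v))\<^sup>2" by (rule power_mono) (simp add: p_def)
    then have "\<kappa> * m1 * real T * (vnorm v)\<^sup>2 \<le> 4 * (vnorm (X *\<^sub>v v))\<^sup>2"
      using p by (simp add: power_mult_distrib)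
    then have "\<kappa> * m1 / 4 * (v \<bullet> v) \<le> v \<bullet> (S *\<^sub>v v)"
      unfolding form[OF v] vnorm_power2 using T by (simp add: field_simps)
    then show "\<kappa> * m1 / 4 * ((L *\<^sub>v u) \<bullet> (L *\<^sub>v u)) \<le> (L *\<^sub>v u) \<bullet> (S *\<^sub>v (L *\<^sub>v u))"
      by (simp add: v_def)
    assume "u \<noteq> 0\<^sub>v r"
    then have "0 < m1 * (vnorm u)\<^sup>2" using scalar_prod_self_pos[OF u] pos by (simp add: vnorm_power2)
    then have "0 < (L *\<^sub>v u) \<bullet> (L *\<^sub>v u)" using Llo[OF u] by (simp add: vnorm_power2)
    then show "L *\<^sub>v u \<noteq> 0\<^sub>v N" by auto
  qed (use r in auto)
  fix j :: nat and a :: real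
  assume j: "1 \<le> j" "j + r \<le> N" and a: "a > 0"
  define G where "G = (1 / a) \<cdot>\<^sub>m (transpose_mat E * E)"
  have G: "G \<in> carrier_mat N N" "transpose_mat G = G"
    unfolding G_def by (rule gram_carrier[OF E], rule gram_symmetric[OF E])
  have "1 \<le> j + r" using j by simp
  then obtain B where B: "B \<in> carrier_mat N (j + r)"
    "\<And>u. u \<in> carrier_vec (j + r) \<Longrightarrow> (B *\<^sub>v u) \<bullet> (B *\<^sub>v u) = u \<bullet> u"
    "\<And>u. u \<in> carrier_vec (j + r) \<Longrightarrow> eig (j + r) G * (u \<bullet> u) \<le> (B *\<^sub>v u) \<bullet> (G *\<^sub>v (B *\<^sub>v u))"
    using eig_top_subspace[OF G] j(2) by blast
  have "eig (j + r) G * (a / real T) \<le> eig j S"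
  \<comment> \<open>\<open>B\<close> spans the leading j + r eigenvectors of the noise Gram matrix;
    the r constraints leave at least j dimensions, enough to test the j-th eigenvalue of
    \<open>S\<close>.\<close>
  proof (rule eig_ge_if_subspace[OF Sc B(1)])
    show "transpose_mat L \<in> carrier_mat r N" using L by simp
    fix u :: "real vec" assume u: "u \<in> carrier_vec (j + r)" and 0: "transpose_mat L *\<^sub>v (B *\<^sub>v u) = 0\<^sub>v r"
    define v where "v = B *\<^sub>v u"
    have v: "v \<in> carrier_vec N" using B u by (simp add: v_def)
    have "eig (j + r) G * (v \<bullet> v) \<le> v \<bullet> (G *\<^sub>v v)"
      using B(3)[OF u] B(2)[OF u] by (simp add: v_def)
    also have "\<dots> = (vnorm (E *\<^sub>v v))\<^sup>2 / a" unfolding G_def gram_quadratic_form[OF E v] by simp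
    also have "\<dots> = v \<bullet> (S *\<^sub>v v) * (real T / a)"
      unfolding form[OF v] using XE[OF v] 0 T by (simp add: v_def)
    finally have "eig (j + r) G * (a / real T) * (v \<bullet> v) \<le> v \<bullet> (S *\<^sub>v v)"
      using a T by (simp add: field_simps)
    then show "eig (j + r) G * (a / real T) * ((B *\<^sub>v u) \<bullet> (B *\<^sub>v u)) \<le> (B *\<^sub>v u) \<bullet> (S *\<^sub>v (B *\<^sub>v u))"
      by (simp add: v_def)
    assume "u \<noteq> 0\<^sub>v (j + r)"
    then have "0 < (B *\<^sub>v u) \<bullet> (B *\<^sub>v u)" using B(2)[OF u] scalar_prod_self_pos[OF u] by simp
    then show "B *\<^sub>v u \<noteq> 0\<^sub>v N" by auto
  qed (use j in auto)
  then show "eig (j + r) ((1 / a) \<cdot>\<^sub>m (transpose_mat E * E)) * (a / real T) \<le> eig j S"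
    by (simp add: G_def)
qed

text \<open>Position \<open>k\<close> is where a lower bound for the noise is known; by monotonicity
  it serves every earlier position, in particular m + 1 + r. The three parts of \<open>small\<close>
  are signal dominance and the comparisons with the earlier and the later ratios.\<close>

lemma factor_model_ratio_max:
  fixes F L E :: "real mat" and T :: nat
  defines "X \<equiv> F * transpose_mat L + E"
  defines "S \<equiv> (1 / real T) \<cdot>\<^sub>m (transpose_mat X * X)"
  assumes F: "F \<in> carrier_mat T r" and L: "L \<in> carrier_mat N r" and E: "E \<in> carrier_mat T N"
    and T: "T \<ge> 1" and r: "r \<ge> 1" "r < m" "m + r + 1 \<le> k" "k \<le> N"
    and Flo: "\<And>u. u \<in> carrier_vec r \<Longrightarrow> \<kappa> * real T * (vnorm u)\<^sup>2 \<le> (vnorm (F *\<^sub>v u))\<^sup>2"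
    and Fhi: "\<And>u. u \<in> carrier_vec r \<Longrightarrow> (vnorm (F *\<^sub>v u))\<^sup>2 \<le> K * real T * (vnorm u)\<^sup>2"
    and Llo: "\<And>u. u \<in> carrier_vec r \<Longrightarrow> m1 * (vnorm u)\<^sup>2 \<le> (vnorm (L *\<^sub>v u))\<^sup>2"
    and Lhi: "\<And>u. u \<in> carrier_vec r \<Longrightarrow> (vnorm (L *\<^sub>v u))\<^sup>2 \<le> m2 * (vnorm u)\<^sup>2"
    and pos: "\<kappa> > 0" "K \<ge> 0" "m1 > 0" "m2 \<ge> 0" "a > 0" "\<gamma> > 0"
    and Eb: "(spec_norm E)\<^sup>2 \<le> b * real T"
    and Ek: "\<gamma> \<le> eig k ((1 / a) \<cdot>\<^sub>m (transpose_mat E * E))"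
    and small: "4 * b \<le> \<kappa> * m1" "2 * (K * m2 + b) * b < (\<kappa> * m1 / 4) * (\<kappa> * m1 / 4)"
      "b * b < (\<kappa> * m1 / 4) * (\<gamma> * (a / real T))"
  shows "\<forall>i \<in> {1..m}. i \<noteq> r \<longrightarrow> eig i S / eig (i + 1) S < eig r S / eig (r + 1) S"
proof (rule consecutive_ratio_max[where a = "\<kappa> * m1 / 4" and b = b and e = "2 * (K * m2 + b)"
      and g = "\<gamma> * (a / real T)"])
  have X: "X \<in> carrier_mat T N" using F L E by (simp add: X_def)
  have Sc: "S \<in> carrier_mat N N" "transpose_mat S = S"
    unfolding S_def by (rule gram_carrier[OF X], rule gram_symmetric[OF X])
  show "eig j S \<le> eig i S" if "1 \<le> i" "i \<le> j" "j \<le> m + 1" for i j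
    by (rule eig_antimono[OF Sc]) (use that r in auto)
  have rN: "r < N" using r by simp
  note bounds = factor_model_eigenvalue_bounds[OF F L E T r(1) rN Flo Fhi Llo Lhi pos(1-4) Eb small(1),
      folded X_def, folded S_def]
  show "eig 1 S \<le> 2 * (K * m2 + b)" "\<kappa> * m1 / 4 \<le> eig r S" "eig (r + 1) S \<le> b"
    using bounds(1-3) by auto
  have "\<gamma> \<le> eig (m + 1 + r) ((1 / a) \<cdot>\<^sub>m (transpose_mat E * E))"
    by (rule order_trans[OF Ek eig_antimono[OF gram_carrier[OF E] gram_symmetric[OF E]]])
       (use r in auto)
  then have "\<gamma> * (a / real T) \<le> eig (m + 1 + r) ((1 / a) \<cdot>\<^sub>m (transpose_mat E * E)) * (a / real T)"
    by (rule mult_right_mono) (use pos in auto)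
  also have "\<dots> \<le> eig (m + 1) S" by (rule bounds(4)) (use r pos in auto)
  finally show "\<gamma> * (a / real T) \<le> eig (m + 1) S" .
qed (use r pos T small in auto)

section \<open>Asymptotic rates and the theorem\<close>

text \<open>The quotient max N T / T is at most 1 + N / T. The first summand leaves a negative power
  of N, as a > 1/2; the second gives exactly the square of the sequence in
  \<open>lim\<close>.\<close>

lemma rate_tendsto_0:
  fixes N T :: "nat \<Rightarrow> nat" and a :: real
  assumes N: "filterlim N at_top sequentially" and T: "filterlim T at_top sequentially"
    and a: "a > 1 / 2"
    and lim: "(\<lambda>n. real (N n) / (sqrt (real (T n)) * real (N n) powr a)) \<longlonglongrightarrow> 0"
  shows "(\<lambda>n. real (N n) powr (1 - 2 * a) * (real (max (N n) (T n)) / real (T n))) \<longlonglongrightarrow> 0"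
proof (rule Lim_null_comparison)
  have "filterlim (\<lambda>n. real (N n)) at_top sequentially"
    by (rule filterlim_compose[OF filterlim_real_sequentially N])
  then have "(\<lambda>n. real (N n) powr (1 - 2 * a)) \<longlonglongrightarrow> 0"
    by (intro tendsto_neg_powr) (use a in auto)
  then show "(\<lambda>n. real (N n) powr (1 - 2 * a)
      + (real (N n) / (sqrt (real (T n)) * real (N n) powr a))\<^sup>2) \<longlonglongrightarrow> 0"
    using tendsto_add[OF _ tendsto_power[OF lim, of 2]] by fastforce
  have "\<forall>\<^sub>F n in sequentially. 1 \<le> N n" "\<forall>\<^sub>F n in sequentially. 1 \<le> T n"
    using N T by (auto simp: filterlim_at_top)
  then show "\<forall>\<^sub>F n in sequentially. norm (real (N n) powr (1 - 2 * a) * (real (max (N n) (T n)) / real (T n)))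
      \<le> real (N n) powr (1 - 2 * a) + (real (N n) / (sqrt (real (T n)) * real (N n) powr a))\<^sup>2"
  proof eventually_elim
    case (elim n)
    define x t where "x = real (N n)" and "t = real (T n)"
    have xt: "x \<ge> 1" "t \<ge> 1" using elim by (auto simp: x_def t_def)
    have "x powr (1 - 2 * a) * (max x t / t) \<le> x powr (1 - 2 * a) * (1 + x / t)"
      by (intro mult_left_mono) (use xt in \<open>auto simp: field_simps\<close>)
    also have "\<dots> = x powr (1 - 2 * a) + x powr (1 - 2 * a) * x / t" by (simp add: algebra_simps)
    also have "x powr (1 - 2 * a) * x / t = (x / (sqrt t * x powr a))\<^sup>2"
    proof -
      have "x powr (1 - 2 * a) = x / (x powr a)\<^sup>2"
        using xt by (simp add: powr_diff power2_eq_square powr_add[symmetric])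
      then show ?thesis using xt by (simp add: power_mult_distrib power_divide power2_eq_square[of x])
    qed
    finally show ?case using xt by (simp add: x_def t_def)
  qed
qed

text \<open>With \<eta> the null sequence and q = N^a, one has N \<rho> = \<eta> q^2, and a \<le> 1
  gives \<rho> \<le> \<eta> q. Dividing the three inequalities by q, q^2 and q \<rho> leaves
  multiples of \<eta> and \<eta>^2 against positive constants, so even the noise term inside the
  bound on the top eigenvalue is harmless.\<close>

lemma eventually_rate_conditions:
  fixes N T :: "nat \<Rightarrow> nat" and a A B D G :: real
  assumes N: "filterlim N at_top sequentially" and T: "filterlim T at_top sequentially"
    and a: "a \<le> 1"
    and rate: "(\<lambda>n. real (N n) powr (1 - 2 * a) * (real (max (N n) (T n)) / real (T n))) \<longlonglongrightarrow> 0"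
    and pos: "A > 0" "B > 0" "D \<ge> 0" "G > 0"
  shows "\<forall>\<^sub>F n in sequentially.
    let q = A * real (N n) powr a; \<rho> = real (max (N n) (T n)) / real (T n); b = B * \<rho>
    in b \<le> q \<and> 2 * (D * real (N n) + b) * b < q * q \<and> b * b < q * (G * \<rho>)"
proof -
  define \<eta> where "\<eta> n = real (N n) powr (1 - 2 * a) * (real (max (N n) (T n)) / real (T n))" for n
  have \<eta>: "\<eta> \<longlonglongrightarrow> 0" using rate unfolding \<eta>_def .
  have lims: "(\<lambda>n. B * \<eta> n) \<longlonglongrightarrow> B * 0" "(\<lambda>n. B * B * \<eta> n) \<longlonglongrightarrow> B * B * 0"
    "(\<lambda>n. 2 * D * B * \<eta> n + 2 * B * B * (\<eta> n * \<eta> n)) \<longlonglongrightarrow> 2 * D * B * 0 + 2 * B * B * (0 * 0)"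
    by (intro tendsto_intros \<eta>)+
  have "\<forall>\<^sub>F n in sequentially. B * \<eta> n < A"
    by (rule order_tendstoD(2)[OF lims(1)]) (use pos in simp)
  moreover have "\<forall>\<^sub>F n in sequentially. B * B * \<eta> n < A * G"
    by (rule order_tendstoD(2)[OF lims(2)]) (use pos in simp)
  moreover have "\<forall>\<^sub>F n in sequentially. 2 * D * B * \<eta> n + 2 * B * B * (\<eta> n * \<eta> n) < A * A"
    by (rule order_tendstoD(2)[OF lims(3)]) (use pos in simp)
  moreover have "\<forall>\<^sub>F n in sequentially. 1 \<le> N n" "\<forall>\<^sub>F n in sequentially. 1 \<le> T n"
    using N T by (auto simp: filterlim_at_top)
  ultimately show ?thesis
  proof eventually_elim
    case (elim n)
    \<comment> \<open>Here \<open>q\<close> is the bare power, without the constant \<open>A\<close>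
      that it carries in the statement.\<close>
    define x q \<rho> where "x = real (N n)" and "q = real (N n) powr a"
      and "\<rho> = real (max (N n) (T n)) / real (T n)"
    have x1: "x \<ge> 1" using elim by (simp add: x_def)
    have q: "q > 0" using x1 by (simp add: q_def x_def)
    have \<rho>: "\<rho> > 0" using elim by (simp add: \<rho>_def)
    have xq: "x powr (1 - 2 * a) * q = x powr (1 - a)"
      by (simp add: q_def x_def powr_add[symmetric])
    have "x powr (1 - 2 * a) * q * q = x powr (1 - a) * x powr a" by (simp add: xq) (simp add: q_def x_def)
    also have "\<dots> = x" using x1 by (simp add: powr_add[symmetric])
    finally have x: "x = x powr (1 - 2 * a) * q * q" ..
    have "x * \<rho> = x powr (1 - 2 * a) * q * q * \<rho>" by (rule arg_cong[OF x])
    also have "\<dots> = \<eta> n * (q * q)" by (simp add: \<eta>_def x_def \<rho>_def)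
    finally have x\<rho>: "x * \<rho> = \<eta> n * (q * q)" .
    have "1 \<le> x powr (1 - a)" using x1 a by (simp add: ge_one_powr_ge_zero)
    then have "1 * \<rho> \<le> x powr (1 - 2 * a) * q * \<rho>"
      unfolding xq using \<rho> by (intro mult_right_mono) auto
    then have \<rho>q: "\<rho> \<le> \<eta> n * q" by (simp add: \<eta>_def x_def \<rho>_def mult_ac)
    have "B * \<rho> \<le> B * \<eta> n * q" using \<rho>q pos by simp
    also have "\<dots> \<le> A * q" by (rule mult_right_mono) (use elim q in auto)
    finally have 1: "B * \<rho> \<le> A * q" .
    have "\<rho> * \<rho> \<le> (\<eta> n * q) * (\<eta> n * q)" by (rule mult_mono') (use \<rho>q \<rho> in auto)
    then have "2 * B * B * (\<rho> * \<rho>) \<le> 2 * B * B * ((\<eta> n * q) * (\<eta> n * q))" using pos by simp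
    then have "2 * (D * x + B * \<rho>) * (B * \<rho>) \<le> 2 * D * B * (x * \<rho>) + 2 * B * B * ((\<eta> n * q) * (\<eta> n * q))"
      by (simp add: algebra_simps)
    also have "\<dots> = (2 * D * B * \<eta> n + 2 * B * B * (\<eta> n * \<eta> n)) * (q * q)"
      unfolding x\<rho> by (simp add: algebra_simps)
    also have "\<dots> < A * A * (q * q)" by (rule mult_strict_right_mono) (use elim q in auto)
    finally have 2: "2 * (D * x + B * \<rho>) * (B * \<rho>) < (A * q) * (A * q)" by (simp add: mult_ac)
    have "B * \<rho> * (B * \<rho>) = B * B * \<rho> * \<rho>" by simp
    also have "\<dots> \<le> B * B * (\<eta> n * q) * \<rho>"
      by (intro mult_right_mono mult_left_mono \<rho>q) (use \<rho> in auto)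
    also have "\<dots> = B * B * \<eta> n * (q * \<rho>)" by simp
    also have "\<dots> < A * G * (q * \<rho>)" by (rule mult_strict_right_mono) (use elim q \<rho> in auto)
    finally have 3: "B * \<rho> * (B * \<rho>) < A * q * (G * \<rho>)" by (simp add: mult_ac)
    show ?case using 1 2 3 by (simp add: Let_def x_def q_def \<rho>_def)
  qed
qed

section \<open>Measurable Gram eigenvalues and the matrix form of the panel\<close>

lemma gram_entries:
  "c \<cdot>\<^sub>m (transpose_mat (mat m n (\<lambda>(t,i). x t i)) * mat m n (\<lambda>(t,i). x t i))
    = mat n n (\<lambda>(i,l). c * (\<Sum>t<m. x t i * x t l))" for c :: real
  by (intro eq_matI) (auto simp: scalar_prod_def lessThan_atLeast0)

lemma borel_measurable_eig_gram:
  fixes x :: "nat \<Rightarrow> nat \<Rightarrow> 'a \<Rightarrow> real"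
  assumes x: "\<And>t i. x t i \<in> borel_measurable M" and j: "1 \<le> j" "j \<le> n"
  shows "(\<lambda>\<omega>. eig j (c \<cdot>\<^sub>m (transpose_mat (mat m n (\<lambda>(t,i). x t i \<omega>)) * mat m n (\<lambda>(t,i). x t i \<omega>))))
    \<in> borel_measurable M"
  unfolding gram_entries
proof (rule borel_measurable_eig[OF _ _ j])
  show "(\<lambda>\<omega>. c * (\<Sum>t<m. x t i \<omega> * x t l \<omega>)) \<in> borel_measurable M" for i l
    using x by measurable
  show "(\<lambda>\<omega>. c * (\<Sum>t<m. x t i \<omega> * x t l \<omega>)) = (\<lambda>\<omega>. c * (\<Sum>t<m. x t l \<omega> * x t i \<omega>))" for i l
    by (simp add: mult.commute)
qed

lemma factor_mat_eq:
  fixes f :: "nat \<Rightarrow> nat \<Rightarrow> real"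
  shows "mat T N (\<lambda>(t,i). (\<Sum>j<r. f t j * g i j) + e t i)
    = mat T r (\<lambda>(t,j). f t j) * transpose_mat (mat N r (\<lambda>(i,j). g i j)) + mat T N (\<lambda>(t,i). e t i)"
  by (intro eq_matI) (auto simp: scalar_prod_def lessThan_atLeast0)

text \<open>Strictness makes \<open>r0\<close> the only maximizer, so the arg max returns it under
  any rule for ties.\<close>

theorem theorem3:
  fixes M :: "'a measure"
    and Nn Tn :: "nat \<Rightarrow> nat"          \<comment> \<open>cross-sectional dimension N and sample size T_0 along the asymptotic sequence\<close>
    and r0 s :: nat                       \<comment> \<open>number of factors / of weak factors\<close>
    and F :: "nat \<Rightarrow> 'a \<Rightarrow> nat \<Rightarrow> nat \<Rightarrow> real"   \<comment> \<open>F n \<omega> t j: entry (t,j) of F^(0)\<close>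
    and Lam :: "nat \<Rightarrow> nat \<Rightarrow> nat \<Rightarrow> real"      \<comment> \<open>Lam n i j: entry (i,j) of Lambda^(0)\<close>
    and Eps :: "nat \<Rightarrow> 'a \<Rightarrow> nat \<Rightarrow> nat \<Rightarrow> real" \<comment> \<open>Eps n \<omega> t i = epsilon_ti\<close>
    and SigmaF :: "real mat"
    and d :: "nat \<Rightarrow> nat \<Rightarrow> real"          \<comment> \<open>diagonal entries of D\<close>
    and \<alpha> :: "nat \<Rightarrow> real"                 \<comment> \<open>alpha_1, ..., alpha_s\<close>
    and Mc C c :: real
    and rmax :: "nat \<Rightarrow> nat"
  defines "Fm \<equiv> \<lambda>n \<omega>. mat (Tn n) r0 (\<lambda>(t,j). F n \<omega> t j)"
    and "Lm \<equiv> \<lambda>n. mat (Nn n) r0 (\<lambda>(i,j). Lam n i j)"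
    and "Em \<equiv> \<lambda>n \<omega>. mat (Tn n) (Nn n) (\<lambda>(t,i). Eps n \<omega> t i)"
    and "Xm \<equiv> \<lambda>n \<omega>. mat (Tn n) (Nn n) (\<lambda>(t,i). (\<Sum>j<r0. F n \<omega> t j * Lam n i j) + Eps n \<omega> t i)"
    and "Dih \<equiv> \<lambda>n. diag_mat r0 (\<lambda>j. 1 / sqrt (d n j))"
  assumes P: "prob_space M"
    and meas_F: "\<And>n t j. (\<lambda>\<omega>. F n \<omega> t j) \<in> borel_measurable M"
    and meas_E: "\<And>n t i. (\<lambda>\<omega>. Eps n \<omega> t i) \<in> borel_measurable M"
    and N_lim: "filterlim Nn at_top sequentially"
    and T_lim: "filterlim Tn at_top sequentially"
    and r0: "r0 \<ge> 1"
    and s: "1 \<le> s" "s \<le> r0"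
    \<comment> \<open>(A1)\<close>
    and A1_mom: "\<And>n t. t < Tn n \<Longrightarrow>
        (\<integral>\<^sup>+\<omega>. ennreal ((\<Sum>j<r0. (F n \<omega> t j)\<^sup>2)\<^sup>2) \<partial>M) \<le> ennreal Mc"
    and A1_conv: "prob_space.conv_in_prob_mat M
        (\<lambda>n \<omega>. (1 / real (Tn n)) \<cdot>\<^sub>m (transpose_mat (Fm n \<omega>) * Fm n \<omega>)) SigmaF"
    and A1_pd: "sym_pos_def SigmaF r0"
    and A1_dist: "distinct (sorted_list_of_multiset (eig_mset SigmaF))"
    \<comment> \<open>(A2)\<close>
    and A2_max: "\<And>n i j. i < Nn n \<Longrightarrow> j < r0 \<Longrightarrow> \<bar>Lam n i j\<bar> \<le> Mc"
    and A2_alpha: "0 < \<alpha> s" "\<alpha> 1 < 1" "\<And>l. 1 \<le> l \<Longrightarrow> l < s \<Longrightarrow> \<alpha> (l + 1) \<le> \<alpha> l"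
    and A2_D: "\<exists>c1 c2. 0 < c1 \<and> 0 < c2 \<and> (\<forall>\<^sub>F n in sequentially.
        (\<forall>j < r0 - s. c1 * real (Nn n) \<le> d n j \<and> d n j \<le> c2 * real (Nn n)) \<and>
        (\<forall>l \<in> {1..s}. c1 * real (Nn n) powr \<alpha> l \<le> d n (r0 - s + l - 1) \<and>
                        d n (r0 - s + l - 1) \<le> c2 * real (Nn n) powr \<alpha> l))"
    and A2_conv: "(\<lambda>n. spec_norm (Dih n * (transpose_mat (Lm n) * Lm n) * Dih n - 1\<^sub>m r0))
        \<longlonglongrightarrow> 0"
    \<comment> \<open>(A3)\<close>
    and A3: "prob_space.bigO_p M (\<lambda>n \<omega>. (spec_norm (Em n \<omega>))\<^sup>2)
        (\<lambda>n. real (max (Nn n) (Tn n)))"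
    \<comment> \<open>(A4)\<close>
    and A4_1: "\<And>n t. t < Tn n \<Longrightarrow>
        (\<integral>\<^sup>+\<omega>. ennreal (\<Sum>j<r0. ((\<Sum>i<Nn n. Lam n i j * Eps n \<omega> t i) / sqrt (d n j))\<^sup>2) \<partial>M)
          \<le> ennreal Mc"
    and A4_2: "\<And>n i. i < Nn n \<Longrightarrow>
        (\<integral>\<^sup>+\<omega>. ennreal (\<Sum>j<r0. ((\<Sum>t<Tn n. F n \<omega> t j * Eps n \<omega> t i) / sqrt (real (Tn n)))\<^sup>2) \<partial>M)
          \<le> ennreal Mc"
    \<comment> \<open>(A6)(1)\<close>
    and A6: "(\<lambda>n. real (Nn n) / (sqrt (real (Tn n)) * real (Nn n) powr \<alpha> s)) \<longlonglongrightarrow> 0"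
    \<comment> \<open>(A7)\<close>
    and A7_C: "0 < C" and A7_c: "0 < c" "c \<le> 1"
    and A7: "prob_space.ge_plus_o_p M
        (\<lambda>n \<omega>. eig (nat \<lfloor>c * real (min (Nn n) (Tn n))\<rfloor>)
           ((1 / real (max (Nn n) (Tn n))) \<cdot>\<^sub>m (transpose_mat (Em n \<omega>) * Em n \<omega>))) C"
    \<comment> \<open>theorem hypotheses\<close>
    and alpha_half: "\<alpha> s > 1 / 2"
    and rmax: "\<forall>\<^sub>F n in sequentially. r0 < rmax n \<and>
        int (rmax n) \<le> \<lfloor>c * real (min (Nn n) (Tn n))\<rfloor> - int r0 - 1"
  shows "(\<lambda>n. prob_space.prob M {\<omega> \<in> space M.
      let Sh = (1 / real (Tn n)) \<cdot>\<^sub>m (transpose_mat (Xm n \<omega>) * Xm n \<omega>)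
      in \<forall>r \<in> {1..rmax n}. r \<noteq> r0 \<longrightarrow> eig r Sh / eig (r + 1) Sh < eig r0 Sh / eig (r0 + 1) Sh})
    \<longlonglongrightarrow> 1"
proof -
  interpret prob_space M by (rule P)
  define \<rho> where "\<rho> n = real (max (Nn n) (Tn n)) / real (Tn n)" for n
  define \<kappa> where "\<kappa> = eig r0 SigmaF / 2"
  define k where "k n = nat \<lfloor>c * real (min (Nn n) (Tn n))\<rfloor>" for n
  define Sh where "Sh n \<omega> = (1 / real (Tn n)) \<cdot>\<^sub>m (transpose_mat (Xm n \<omega>) * Xm n \<omega>)" for n \<omega>
  \<comment> \<open>All randomness that matters is in these three quantities, since the loadings are
    not random: \<open>A1_conv\<close> controls \<open>Z1\<close>, \<open>A3\<close> controls
    \<open>Z2\<close> and \<open>A7\<close> controls \<open>Z3\<close>.\<close>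
  define Z1 where "Z1 n \<omega> = spec_norm ((1 / real (Tn n)) \<cdot>\<^sub>m (transpose_mat (Fm n \<omega>) * Fm n \<omega>) - SigmaF)" for n \<omega>
  define Z2 where "Z2 n \<omega> = (spec_norm (Em n \<omega>))\<^sup>2" for n \<omega>
  define Z3 where "Z3 n \<omega> = eig (k n) ((1 / real (max (Nn n) (Tn n))) \<cdot>\<^sub>m (transpose_mat (Em n \<omega>) * Em n \<omega>))" for n \<omega>
  define Q where "Q n \<omega> \<longleftrightarrow> (\<forall>r \<in> {1..rmax n}. r \<noteq> r0 \<longrightarrow>
    eig r (Sh n \<omega>) / eig (r + 1) (Sh n \<omega>) < eig r0 (Sh n \<omega>) / eig (r0 + 1) (Sh n \<omega>))" for n \<omega>
  have \<kappa>: "\<kappa> > 0" using sym_pos_def_eig(1)[OF A1_pd r0] by (simp add: \<kappa>_def)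
  have "eig r0 SigmaF \<le> eig 1 SigmaF"
    by (rule eig_antimono) (use A1_pd r0 in \<open>auto simp: sym_pos_def_def\<close>)
  then have K: "2 * eig 1 SigmaF \<ge> 0" using sym_pos_def_eig(1)[OF A1_pd r0] by linarith
  have \<alpha>_mono: "\<alpha> s \<le> \<alpha> l \<and> \<alpha> l \<le> \<alpha> 1" if "l \<in> {1..s}" for l
  proof
    have *: "\<alpha> (i + m) \<le> \<alpha> i" if "1 \<le> i" "i + m \<le> s" for i m
      using that
    proof (induction m)
      case (Suc m)
      then show ?case using A2_alpha(3)[of "i + m"] by simp
    qed simp
    show "\<alpha> s \<le> \<alpha> l" "\<alpha> l \<le> \<alpha> 1" using *[of l "s - l"] *[of 1 "l - 1"] that by auto
  qed
  have \<alpha>1: "\<alpha> s \<le> 1" using \<alpha>_mono[of s] s A2_alpha(2) by auto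
  note rate = rate_tendsto_0[OF N_lim T_lim alpha_half A6]
  obtain c1 c2 where c12: "0 < c1" "0 < c2" and D: "\<forall>\<^sub>F n in sequentially.
        (\<forall>j < r0 - s. c1 * real (Nn n) \<le> d n j \<and> d n j \<le> c2 * real (Nn n)) \<and>
        (\<forall>l \<in> {1..s}. c1 * real (Nn n) powr \<alpha> l \<le> d n (r0 - s + l - 1) \<and>
                        d n (r0 - s + l - 1) \<le> c2 * real (Nn n) powr \<alpha> l)"
    using A2_D by blast
  have N1: "\<forall>\<^sub>F n in sequentially. 1 \<le> Nn n" and T1: "\<forall>\<^sub>F n in sequentially. 1 \<le> Tn n"
    using N_lim T_lim by (auto simp: filterlim_at_top)
  \<comment> \<open>The eigenvalue bounds see only the extremes of the loading strengths: strong and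
    weak entries alike lie between the order of the weakest factor and the order of N.\<close>
  have dbounds: "\<forall>\<^sub>F n in sequentially. \<forall>j<r0.
      c1 * real (Nn n) powr \<alpha> s \<le> d n j \<and> d n j \<le> c2 * real (Nn n)"
    using D N1
  proof eventually_elim
    case (elim n)
    have N: "1 \<le> real (Nn n)" using elim by simp
    show ?case
    proof (intro allI impI)
      fix j assume j: "j < r0"
      show "c1 * real (Nn n) powr \<alpha> s \<le> d n j \<and> d n j \<le> c2 * real (Nn n)"
      proof (cases "j < r0 - s")
        case True
        have "real (Nn n) powr \<alpha> s \<le> real (Nn n) powr 1" by (rule powr_mono[OF \<alpha>1 N])
        then have "c1 * real (Nn n) powr \<alpha> s \<le> c1 * real (Nn n)" using c12 N by simp
        then show ?thesis using elim True by fastforce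
      next
        case False
        \<comment> \<open>Weak factors are numbered from 1 and stored after the r0 - s strong ones,
          at positions counted from 0.\<close>
        define l where "l = j - (r0 - s) + 1"
        have l: "l \<in> {1..s}" "r0 - s + l - 1 = j" using False j s by (auto simp: l_def)
        have "real (Nn n) powr \<alpha> s \<le> real (Nn n) powr \<alpha> l" "real (Nn n) powr \<alpha> l \<le> real (Nn n) powr 1"
          by (rule powr_mono[OF _ N]; use \<alpha>_mono[OF l(1)] A2_alpha(2) in simp)+
        then have "c1 * real (Nn n) powr \<alpha> s \<le> c1 * real (Nn n) powr \<alpha> l"
          "c2 * real (Nn n) powr \<alpha> l \<le> c2 * real (Nn n)" using c12 N by auto
        moreover have "c1 * real (Nn n) powr \<alpha> l \<le> d n j \<and> d n j \<le> c2 * real (Nn n) powr \<alpha> l"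
          using elim l by metis
        ultimately show ?thesis by linarith
      qed
    qed
  qed
  have Dih_ev: "\<forall>\<^sub>F n in sequentially.
      spec_norm (Dih n * (transpose_mat (Lm n) * Lm n) * Dih n - 1\<^sub>m r0) < 1 / 2"
    using order_tendstoD(2)[OF A2_conv, of "1 / 2"] by simp
  \<comment> \<open>Since \<open>rmax n\<close> is a natural number, the floor is positive and
    \<open>nat\<close> truncates nothing; c \<le> 1 keeps \<open>k n\<close> within the N
    eigenvalues.\<close>
  have dims: "\<forall>\<^sub>F n in sequentially. r0 < rmax n \<and> rmax n + r0 + 1 \<le> k n \<and> k n \<le> Nn n"
    using rmax N1
  proof eventually_elim
    case (elim n)
    have "c * real (min (Nn n) (Tn n)) \<le> 1 * real (Nn n)"
      by (rule mult_mono) (use A7_c in auto)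
    then have "\<lfloor>c * real (min (Nn n) (Tn n))\<rfloor> \<le> int (Nn n)" by linarith
    then show ?case using elim unfolding k_def by linarith
  qed
  \<comment> \<open>The threshold on n does not depend on \<omega>, so for each large n this is an
    inclusion of events. \<open>B\<close> stays arbitrary because the constant supplied by
    \<open>A3\<close> depends on the probability level.\<close>
  have main: "\<forall>\<^sub>F n in sequentially. \<forall>\<omega>. Z1 n \<omega> \<le> eig r0 SigmaF / 2 \<longrightarrow>
      Z2 n \<omega> \<le> B * real (max (Nn n) (Tn n)) \<longrightarrow> C / 2 \<le> Z3 n \<omega> \<longrightarrow> Q n \<omega>" if B: "B > 0" for B
  proof -
    have "\<forall>\<^sub>F n in sequentially.
      let q = (\<kappa> * c1 / 8) * real (Nn n) powr \<alpha> s; \<rho> = real (max (Nn n) (Tn n)) / real (Tn n); b = B * \<rho>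
      in b \<le> q \<and> 2 * ((2 * eig 1 SigmaF * (2 * c2)) * real (Nn n) + b) * b < q * q \<and> b * b < q * (C / 2 * \<rho>)"
      by (rule eventually_rate_conditions[OF N_lim T_lim \<alpha>1 rate]) (use \<kappa> K c12 B A7_C in auto)
    then show ?thesis using dbounds Dih_ev dims N1 T1
    proof eventually_elim
      case (elim n)
      \<comment> \<open>The loading bounds lose a factor 2 on either side. Hence \<kappa> m1 / 4
        carries the constant \<kappa> c1 / 8, and \<open>m2\<close> the factor 2 c2, of the rate
        conditions above.\<close>
      define m1 m2 where "m1 = c1 * real (Nn n) powr \<alpha> s / 2" and "m2 = 2 * (c2 * real (Nn n))"
      have small: "4 * (B * \<rho> n) \<le> \<kappa> * m1"
        "2 * (2 * eig 1 SigmaF * m2 + B * \<rho> n) * (B * \<rho> n) < (\<kappa> * m1 / 4) * (\<kappa> * m1 / 4)"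
        "B * \<rho> n * (B * \<rho> n) < (\<kappa> * m1 / 4) * (C / 2 * \<rho> n)"
        using elim(1) by (auto simp: Let_def \<rho>_def m1_def m2_def mult_ac)
      have lo: "c1 * real (Nn n) powr \<alpha> s > 0" using c12 elim by simp
      have Fc: "Fm n \<omega> \<in> carrier_mat (Tn n) r0" and Ec: "Em n \<omega> \<in> carrier_mat (Tn n) (Nn n)" for \<omega>
        by (auto simp: Fm_def Em_def)
      have Lc: "Lm n \<in> carrier_mat (Nn n) r0" by (simp add: Lm_def)
      have near: "spec_norm (Defs.diag_mat r0 (\<lambda>j. 1 / sqrt (d n j)) * (transpose_mat (Lm n) * Lm n)
        * Defs.diag_mat r0 (\<lambda>j. 1 / sqrt (d n j)) - 1\<^sub>m r0) \<le> 1 / 2"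
        using elim(3) by (simp add: Dih_def)
      have db: "c1 * real (Nn n) powr \<alpha> s \<le> d n j \<and> d n j \<le> c2 * real (Nn n)" if "j < r0" for j
        using elim(2) that by blast
      show ?case
      proof (intro allI impI)
        fix \<omega>
        assume Z: "Z1 n \<omega> \<le> eig r0 SigmaF / 2" "Z2 n \<omega> \<le> B * real (max (Nn n) (Tn n))" "C / 2 \<le> Z3 n \<omega>"
        have Xm_eq: "Xm n \<omega> = Fm n \<omega> * transpose_mat (Lm n) + Em n \<omega>"
          unfolding Xm_def Fm_def Lm_def Em_def by (rule factor_mat_eq)
        show "Q n \<omega>" unfolding Q_def Sh_def Xm_eq
        proof (rule factor_model_ratio_max[where \<kappa> = \<kappa> and K = "2 * eig 1 SigmaF" and ?m1.0 = m1 and ?m2.0 = m2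
              and a = "real (max (Nn n) (Tn n))" and \<gamma> = "C / 2" and b = "B * \<rho> n" and k = "k n"])
          show "\<kappa> * real (Tn n) * (vnorm u)\<^sup>2 \<le> (vnorm (Fm n \<omega> *\<^sub>v u))\<^sup>2"
            "(vnorm (Fm n \<omega> *\<^sub>v u))\<^sup>2 \<le> 2 * eig 1 SigmaF * real (Tn n) * (vnorm u)\<^sup>2"
            if "u \<in> carrier_vec r0" for u
            using gram_near_pos_def_bounds[OF Fc _ r0 A1_pd _ that] elim Z(1) by (auto simp: \<kappa>_def Z1_def)
          show "m1 * (vnorm u)\<^sup>2 \<le> (vnorm (Lm n *\<^sub>v u))\<^sup>2" "(vnorm (Lm n *\<^sub>v u))\<^sup>2 \<le> m2 * (vnorm u)\<^sup>2"
            if "u \<in> carrier_vec r0" for u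
            using scaled_gram_near_identity_bounds[OF Lc db lo near that] by (auto simp: m1_def m2_def)
          show "(spec_norm (Em n \<omega>))\<^sup>2 \<le> B * \<rho> n * real (Tn n)"
            using Z(2) elim by (simp add: Z2_def \<rho>_def)
          show "C / 2 \<le> eig (k n) ((1 / real (max (Nn n) (Tn n))) \<cdot>\<^sub>m (transpose_mat (Em n \<omega>) * Em n \<omega>))"
            using Z(3) by (simp add: Z3_def)
          show "B * \<rho> n * (B * \<rho> n) < (\<kappa> * m1 / 4) * (C / 2 * (real (max (Nn n) (Tn n)) / real (Tn n)))"
            using small(3) by (simp add: \<rho>_def)
        qed (use Fc Ec Lc elim \<kappa> K c12 r0 A7_C lo small(1,2) in \<open>auto simp: m1_def m2_def\<close>)
      qed
    qed
  qed
  have Z1_meas: "Z1 n \<in> borel_measurable M" for n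
  proof -
    have "Z1 n = (\<lambda>\<omega>. spec_norm (mat r0 r0 (\<lambda>(i,l).
        1 / real (Tn n) * (\<Sum>t<Tn n. F n \<omega> t i * F n \<omega> t l) - SigmaF $$ (i,l))))"
      unfolding Z1_def Fm_def gram_entries
      by (intro ext arg_cong[of _ _ spec_norm] eq_matI)
        (use A1_pd in \<open>auto simp: sym_pos_def_def\<close>)
    also have "\<dots> \<in> borel_measurable M"
    proof (rule borel_measurable_spec_norm[OF _ r0])
      show "(\<lambda>\<omega>. 1 / real (Tn n) * (\<Sum>t<Tn n. F n \<omega> t i * F n \<omega> t l) - SigmaF $$ (i,l)) \<in> borel_measurable M"
        for i l using meas_F by measurable
    qed
    finally show ?thesis .
  qed
  have Z2_meas: "Z2 n \<in> borel_measurable M" if "1 \<le> Nn n" for n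
    unfolding Z2_def[abs_def] Em_def
    by (intro borel_measurable_power borel_measurable_spec_norm[OF meas_E that])
  have Z3_meas: "Z3 n \<in> borel_measurable M" if "1 \<le> k n" "k n \<le> Nn n" for n
    unfolding Z3_def[abs_def] Em_def
    by (rule borel_measurable_eig_gram[OF meas_E that])
  have Sh_meas: "(\<lambda>\<omega>. eig j (Sh n \<omega>)) \<in> borel_measurable M" if "1 \<le> j" "j \<le> Nn n" for n j
    unfolding Sh_def Xm_def
    by (rule borel_measurable_eig_gram[OF _ that]) (use meas_F meas_E in measurable)
  have Q_meas: "{\<omega> \<in> space M. Q n \<omega>} \<in> sets M" if "r0 + 1 \<le> Nn n" "rmax n + 1 \<le> Nn n" for n
    unfolding Q_def
  proof (rule sets.sets_Collect_finite_All)
    fix r assume r: "r \<in> {1..rmax n}"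
    have "{\<omega> \<in> space M. eig r (Sh n \<omega>) / eig (r + 1) (Sh n \<omega>) < eig r0 (Sh n \<omega>) / eig (r0 + 1) (Sh n \<omega>)} \<in> sets M"
      by (intro borel_measurable_less borel_measurable_divide Sh_meas) (use r r0 that in auto)
    then show "{\<omega> \<in> space M. r \<noteq> r0 \<longrightarrow>
        eig r (Sh n \<omega>) / eig (r + 1) (Sh n \<omega>) < eig r0 (Sh n \<omega>) / eig (r0 + 1) (Sh n \<omega>)} \<in> sets M"
      by (cases "r = r0") auto
  qed simp
  have lim: "(\<lambda>n. prob {\<omega> \<in> space M. Q n \<omega>}) \<longlonglongrightarrow> 1"
  proof (rule order_tendstoI)
    fix a :: real assume "1 < a"
    then show "\<forall>\<^sub>F n in sequentially. prob {\<omega> \<in> space M. Q n \<omega>} < a"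
      by (intro always_eventually allI) (use prob_le_1 in \<open>auto intro: le_less_trans\<close>)
  next
    fix a :: real assume "a < 1"
    \<comment> \<open>One third of the slack goes to each of the three exceptional events.\<close>
    define e where "e = (1 - a) / 3"
    have e: "e > 0" using \<open>a < 1\<close> by (simp add: e_def)
    define B1 where "B1 n = {\<omega> \<in> space M. Z1 n \<omega> > eig r0 SigmaF / 2}" for n
    have "(\<lambda>n. prob (B1 n)) \<longlonglongrightarrow> 0"
      using A1_conv \<kappa> unfolding conv_in_prob_mat_def B1_def Z1_def \<kappa>_def by blast
    then have p1: "\<forall>\<^sub>F n in sequentially. prob (B1 n) < e" using e by (rule order_tendstoD(2))
    obtain B0 n0 where B0: "\<And>n. n \<ge> n0 \<Longrightarrow>
        prob {\<omega> \<in> space M. \<bar>Z2 n \<omega>\<bar> > B0 * real (max (Nn n) (Tn n))} < e"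
      using A3 e unfolding bigO_p_def Z2_def by blast
    define B2 where "B2 n = {\<omega> \<in> space M. \<bar>Z2 n \<omega>\<bar> > B0 * real (max (Nn n) (Tn n))}" for n
    have p2: "\<forall>\<^sub>F n in sequentially. prob (B2 n) < e"
      using B0 unfolding B2_def eventually_sequentially by blast
    \<comment> \<open>The tolerance C / 2 still leaves the noise eigenvalue at least C / 2 off this
      event.\<close>
    define B3 where "B3 n = {\<omega> \<in> space M. Z3 n \<omega> < C - C / 2}" for n
    have "(\<lambda>n. prob (B3 n)) \<longlonglongrightarrow> 0"
      using A7 A7_C unfolding ge_plus_o_p_def B3_def Z3_def k_def by (meson half_gt_zero)
    then have p3: "\<forall>\<^sub>F n in sequentially. prob (B3 n) < e" using e by (rule order_tendstoD(2))
    \<comment> \<open>The constant from \<open>A3\<close> carries no sign, while \<open>main\<close>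
      wants a positive one; enlarging it only weakens the bound on \<open>Z2\<close>.\<close>
    have "max B0 1 > 0" by simp
    from main[OF this] p1 p2 p3 dims N1
    show "\<forall>\<^sub>F n in sequentially. a < prob {\<omega> \<in> space M. Q n \<omega>}"
    proof eventually_elim
      case (elim n)
      have k: "1 \<le> k n" "k n \<le> Nn n" using elim by auto
      have B_sets: "B1 n \<in> sets M" "B2 n \<in> sets M" "B3 n \<in> sets M"
        unfolding B1_def B2_def B3_def using Z1_meas[of n] Z2_meas[of n] Z3_meas[OF k] elim by measurable
      have Q_sets: "{\<omega> \<in> space M. Q n \<omega>} \<in> sets M" by (rule Q_meas) (use elim in auto)
      have "space M - {\<omega> \<in> space M. Q n \<omega>} \<subseteq> B1 n \<union> B2 n \<union> B3 n"
      proof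
        fix \<omega> assume \<omega>: "\<omega> \<in> space M - {\<omega> \<in> space M. Q n \<omega>}"
        show "\<omega> \<in> B1 n \<union> B2 n \<union> B3 n"
        proof (rule ccontr)
          assume "\<omega> \<notin> B1 n \<union> B2 n \<union> B3 n"
          then have 1: "Z1 n \<omega> \<le> eig r0 SigmaF / 2" and 3: "C / 2 \<le> Z3 n \<omega>"
            and 2: "Z2 n \<omega> \<le> B0 * real (max (Nn n) (Tn n))"
            using \<omega> by (auto simp: B1_def B2_def B3_def not_less)
          note 2
          also have "B0 * real (max (Nn n) (Tn n)) \<le> max B0 1 * real (max (Nn n) (Tn n))"
            by (rule mult_right_mono) auto
          finally have "Q n \<omega>" using elim(1) 1 3 by blast
          then show False using \<omega> by simp
        qed
      qed
      then have "prob (space M - {\<omega> \<in> space M. Q n \<omega>}) \<le> prob (B1 n \<union> B2 n \<union> B3 n)"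
        by (rule finite_measure_mono) (use B_sets in auto)
      also have "\<dots> \<le> prob (B1 n) + prob (B2 n) + prob (B3 n)"
        using measure_Un_le[of "B1 n \<union> B2 n" M "B3 n"]
          measure_Un_le[of "B1 n" M "B2 n"] B_sets by auto
      finally have "1 - prob {\<omega> \<in> space M. Q n \<omega>} < 3 * e"
        using elim prob_compl[OF Q_sets] by linarith
      then show ?case by (simp add: e_def)
    qed
  qed
  show ?thesis using lim unfolding Q_def Sh_def Let_def .
qed

end
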